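(* Let $(f_n)$ be a sequence of Boolean functions such that each $f_n$ is $p_n$-knowable for some $p_n>\tfrac12$. If $H(f_n)\to0$, then $(f_n)$ is noise sensitive.
   Context: Let $\Omega=\{-1,1\}$ and $\Omega^\infty=\{-1,1\}^{\mathbb N}$ with the uniform product probability measure; $\omega$ denotes a uniformly random element. A Boolean function is a measurable map $f:\Omega^\infty\to\Omega$. $\omega^{(k)}$ is $\omega$ with bit $k$ flipped; $I_k(f)=\mathbb P(f(\omega^{(k)})\ne f(\omega))$, $H(f)=\sum_kI_k(f)^2$. A set $W\subseteq\mathbb N$ is a witness set for $f$ at $\omega$ if there is an event $A$ with $\mathbb P(A)=1$ such that for all $\tilde\omega\in A$: if $\tilde\omega_i=\omega_i$ for all $i\in W$ then $f(\tilde\omega)=f(\omega)$. $f$ is finitary if almost surely a finite witness set exists; then $W(f)(\omega)$ denotes the least finite witness set in the order: smaller maximum first, then smaller cardinality, then lexicographic. $f$ is $p$-knowable if it is finitary and $\mathbb E[(\max W(f))^p]<\infty$. For $\epsilon\in[0,1]$, $\omega^\epsilon$ is obtained from $\omega$ by, independently for each coordinate, with probability $\epsilon$ replacing $\omega_i$ by a fresh uniform bit. A sequence $(f_n)$ is noise sensitive if for every $\epsilon\in(0,1]$, $\mathbb E[f_n(\omega)f_n(\omega^\epsilon)]-\mathbb E[f_n(\omega)]^2\to0$. *)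

theory Defs
  imports "HOL-Probability.Probability"
begin

definition pm :: "bool \<Rightarrow> real" where
  "pm b = (if b then 1 else -1)"

definition cube :: "(nat \<Rightarrow> bool) measure" where
  "cube = PiM UNIV (\<lambda>_. measure_pmf (bernoulli_pmf (1/2)))"

definition boolean_function :: "((nat \<Rightarrow> bool) \<Rightarrow> bool) \<Rightarrow> bool" where
  "boolean_function f \<longleftrightarrow> f \<in> measurable cube (count_space UNIV)"

definition flip :: "nat \<Rightarrow> (nat \<Rightarrow> bool) \<Rightarrow> (nat \<Rightarrow> bool)" where
  "flip k w = w(k := (\<not> w k))"

definition influence :: "((nat \<Rightarrow> bool) \<Rightarrow> bool) \<Rightarrow> nat \<Rightarrow> real" where
  "influence f k = measure cube {w \<in> space cube. f (flip k w) \<noteq> f w}"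

definition H :: "((nat \<Rightarrow> bool) \<Rightarrow> bool) \<Rightarrow> ennreal" where
  "H f = (\<Sum>k. ennreal ((influence f k)\<^sup>2))"

definition witness_set :: "((nat \<Rightarrow> bool) \<Rightarrow> bool) \<Rightarrow> (nat \<Rightarrow> bool) \<Rightarrow> nat set \<Rightarrow> bool" where
  "witness_set f w W \<longleftrightarrow>
     (\<exists>A \<in> sets cube. measure cube A = 1 \<and>
        (\<forall>w' \<in> A. (\<forall>i \<in> W. w' i = w i) \<longrightarrow> f w' = f w))"

definition finitary :: "((nat \<Rightarrow> bool) \<Rightarrow> bool) \<Rightarrow> bool" where
  "finitary f \<longleftrightarrow> (AE w in cube. \<exists>W. finite W \<and> witness_set f w W)"

definition maxi :: "nat set \<Rightarrow> nat" where
  "maxi W = (if W = {} then 0 else Max W)"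

definition set_less :: "nat set \<Rightarrow> nat set \<Rightarrow> bool" where
  "set_less W W' \<longleftrightarrow>
     maxi W < maxi W' \<or>
     (maxi W = maxi W' \<and>
       (card W < card W' \<or>
        (card W = card W' \<and>
          (sorted_list_of_set W, sorted_list_of_set W') \<in> lexord {(a, b). a < b})))"

definition least_witness :: "((nat \<Rightarrow> bool) \<Rightarrow> bool) \<Rightarrow> (nat \<Rightarrow> bool) \<Rightarrow> nat set" where
  "least_witness f w =
     (THE W. finite W \<and> witness_set f w W \<and>
        (\<forall>W'. finite W' \<and> witness_set f w W' \<and> W' \<noteq> W \<longrightarrow> set_less W W'))"

definition knowable :: "real \<Rightarrow> ((nat \<Rightarrow> bool) \<Rightarrow> bool) \<Rightarrow> bool" where
  "knowable p f \<longleftrightarrow> finitary f \<and>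
     (\<integral>\<^sup>+ w. ennreal (real (maxi (least_witness f w)) powr p) \<partial>cube) < \<infinity>"

definition noise_pmf :: "real \<Rightarrow> (bool \<times> bool) pmf" where
  "noise_pmf \<epsilon> =
     do { x \<leftarrow> bernoulli_pmf (1/2);
          r \<leftarrow> bernoulli_pmf \<epsilon>;
          y \<leftarrow> bernoulli_pmf (1/2);
          return_pmf (x, if r then y else x) }"

definition noise_cube :: "real \<Rightarrow> (nat \<Rightarrow> bool \<times> bool) measure" where
  "noise_cube \<epsilon> = PiM UNIV (\<lambda>_. measure_pmf (noise_pmf \<epsilon>))"

definition noise_sensitive :: "(nat \<Rightarrow> (nat \<Rightarrow> bool) \<Rightarrow> bool) \<Rightarrow> bool" where
  "noise_sensitive fs \<longleftrightarrow>
     (\<forall>\<epsilon>. 0 < \<epsilon> \<and> \<epsilon> \<le> 1 \<longrightarrow>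
        (\<lambda>n. (\<integral>z. pm (fs n (fst \<circ> z)) * pm (fs n (snd \<circ> z)) \<partial>noise_cube \<epsilon>)
              - (\<integral>w. pm (fs n w) \<partial>cube)\<^sup>2) \<longlonglongrightarrow> 0)"

end

theory Submission
  imports Defs
begin

text \<open>
  Write \<open>F = pm \<circ> f\<close> with Walsh--Fourier coefficients \<open>fourier F S\<close>. Since Walsh polynomials are
  dense in \<open>L\<^sup>2\<close>, the noise covariance is the sum of \<open>(1 - \<epsilon>) ^ card S * (fourier F S)\<^sup>2\<close> over
  the nonempty finite sets \<open>S\<close>, so it suffices that for each fixed \<open>d > 0\<close> the weight of the sets of
  size \<open>d\<close> is at most a constant times \<open>sqrt (H f)\<close>. Following Keller and Kindler, split the
  coordinates into \<open>J\<close> and its complement and consider the sets that meet \<open>J\<close> in a single point; a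
  truncation argument, with Bonami's fourth moment inequality for the tails, bounds their weight,
  and averaging over \<open>J\<close> recovers the whole level. All these estimates hold directly on the
  infinite cube and use only that the measure is invariant under flipping a coordinate.
\<close>

section \<open>Bounded measurable functions and product measures\<close>

text \<open>An influence controls only the correlation of \<open>f\<close> with a bounded
  multiplier, and the price is the sup norm of that multiplier. The natural multipliers are Walsh
  polynomials, whose sup norm can grow with the number of coordinates; only their L2 norm is at
  hand. Truncation at \<open>t\<close> times the L2 norm repairs this, and the degree-only constant
  \<open>9 ^ d\<close> bounds the discarded tail. The tails must still be added over
  \<open>i\<close> without loss, which needs orthogonality. Truncation destroys the Walsh expansion,
  so orthogonality has to come from the sign \<open>pm (w i)\<close> alone, and this forces
  multipliers that are free of every coordinate in \<open>J\<close>. Hence the split, at the price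
  of a factor \<open>2 ^ Suc d\<close>. The errors \<open>t * sqrt h\<close> and
  \<open>3 ^ d / t\<close> balance when \<open>t\<close> is the inverse fourth root of
  \<open>h\<close>, the origin of the rate \<open>sqrt h\<close>. No constant depends on the finite
  set \<open>A\<close>, so \<open>A\<close> may be chosen after \<open>f\<close> and the
  approximation error, and it disappears from the final bound.\<close>

definition bounded_measurable :: "'a measure \<Rightarrow> ('a \<Rightarrow> real) \<Rightarrow> bool" where
  "bounded_measurable M f \<longleftrightarrow> f \<in> borel_measurable M \<and> (\<exists>B. \<forall>x. \<bar>f x\<bar> \<le> B)"

text \<open>The class is an algebra, stable under composition with measurable maps and integrable
  for finite measures, so nearly all integrability conditions below reduce to these rules.\<close>

named_theorems bm_intros

lemma bounded_measurableD [dest]: "bounded_measurable M f \<Longrightarrow> f \<in> borel_measurable M"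
  by (simp add: bounded_measurable_def)

lemma bounded_measurable_const [bm_intros]: "bounded_measurable M (\<lambda>_. c)"
  by (auto simp: bounded_measurable_def)

lemma bounded_measurable_add [bm_intros]:
  assumes "bounded_measurable M f" "bounded_measurable M g"
  shows "bounded_measurable M (\<lambda>x. f x + g x)"
proof -
  obtain B C where "\<And>x. \<bar>f x\<bar> \<le> B" "\<And>x. \<bar>g x\<bar> \<le> C"
    using assms by (auto simp: bounded_measurable_def)
  then have "\<bar>f x + g x\<bar> \<le> B + C" for x
    by (meson abs_triangle_ineq add_mono order_trans)
  with assms show ?thesis
    by (auto simp: bounded_measurable_def)
qed

lemma bounded_measurable_mult [bm_intros]:
  assumes "bounded_measurable M f" "bounded_measurable M g"
  shows "bounded_measurable M (\<lambda>x. f x * g x)"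
proof -
  obtain B C where "\<And>x. \<bar>f x\<bar> \<le> B" "\<And>x. \<bar>g x\<bar> \<le> C"
    using assms by (auto simp: bounded_measurable_def)
  then have "\<bar>f x * g x\<bar> \<le> B * C" for x
    unfolding abs_mult by (meson abs_ge_zero mult_mono order_trans)
  with assms show ?thesis
    by (auto simp: bounded_measurable_def)
qed

lemma bounded_measurable_uminus [bm_intros]:
  "bounded_measurable M f \<Longrightarrow> bounded_measurable M (\<lambda>x. - f x)"
  by (auto simp: bounded_measurable_def)

lemma bounded_measurable_diff [bm_intros]:
  "bounded_measurable M f \<Longrightarrow> bounded_measurable M g \<Longrightarrow> bounded_measurable M (\<lambda>x. f x - g x)"
  using bounded_measurable_add[of M f "\<lambda>x. - g x"] bounded_measurable_uminus[of M g] by simp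

lemma bounded_measurable_power [bm_intros]:
  "bounded_measurable M f \<Longrightarrow> bounded_measurable M (\<lambda>x. f x ^ n)"
  by (induction n) (auto intro: bm_intros)

lemma bounded_measurable_sum [bm_intros]:
  "(\<And>i. i \<in> A \<Longrightarrow> bounded_measurable M (f i)) \<Longrightarrow> bounded_measurable M (\<lambda>x. \<Sum>i\<in>A. f i x)"
  by (induction A rule: infinite_finite_induct) (auto intro: bm_intros)

lemma bounded_measurable_prod [bm_intros]:
  "(\<And>i. i \<in> A \<Longrightarrow> bounded_measurable M (f i)) \<Longrightarrow> bounded_measurable M (\<lambda>x. \<Prod>i\<in>A. f i x)"
  by (induction A rule: infinite_finite_induct) (auto intro: bm_intros)

lemma bounded_measurable_compose:
  "bounded_measurable N f \<Longrightarrow> h \<in> measurable M N \<Longrightarrow> bounded_measurable M (\<lambda>x. f (h x))"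
  by (auto simp: bounded_measurable_def)

lemma bounded_measurable_indicator [bm_intros]:
  "A \<in> sets M \<Longrightarrow> bounded_measurable M (indicator A)"
  by (auto simp: bounded_measurable_def intro!: exI[of _ 1] split: split_indicator)

lemma bounded_measurable_integrable:
  "finite_measure M \<Longrightarrow> bounded_measurable M f \<Longrightarrow> integrable M f"
  by (auto simp: bounded_measurable_def intro!: finite_measure.integrable_const_bound AE_I2)

text \<open>The integral of the square of \<open>f - s * g\<close> is a nonnegative quadratic in
  \<open>s\<close>; the claim is the sign of its discriminant.\<close>

lemma Cauchy_Schwarz_integral:
  fixes f g :: "'a \<Rightarrow> real"
  assumes "finite_measure M" "bounded_measurable M f" "bounded_measurable M g"
  shows "(\<integral>x. f x * g x \<partial>M)\<^sup>2 \<le> (\<integral>x. (f x)\<^sup>2 \<partial>M) * (\<integral>x. (g x)\<^sup>2 \<partial>M)"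
proof -
  let ?a = "\<integral>x. (f x)\<^sup>2 \<partial>M" and ?b = "\<integral>x. f x * g x \<partial>M" and ?c = "\<integral>x. (g x)\<^sup>2 \<partial>M"
  note [intro] = bounded_measurable_integrable[OF assms(1)] bm_intros assms(2,3)
  have quad: "0 \<le> ?a - 2 * s * ?b + s\<^sup>2 * ?c" for s
  proof -
    have "0 \<le> (\<integral>x. (f x - s * g x)\<^sup>2 \<partial>M)" by simp
    also have "\<dots> = (\<integral>x. (f x)\<^sup>2 - 2 * s * (f x * g x) + s\<^sup>2 * (g x)\<^sup>2 \<partial>M)"
      by (intro Bochner_Integration.integral_cong) (auto simp: power2_eq_square algebra_simps)
    also have "\<dots> = ?a - 2 * s * ?b + s\<^sup>2 * ?c"
    proof -
      have "integrable M (\<lambda>x. (f x)\<^sup>2)" "integrable M (\<lambda>x. f x * g x)" "integrable M (\<lambda>x. (g x)\<^sup>2)"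
        by blast+
      then show ?thesis by simp
    qed
    finally show ?thesis .
  qed
  show ?thesis
  proof (cases "?c = 0")
    case True
    have "?b = 0"
    proof (rule ccontr)
      assume "?b \<noteq> 0"
      \<comment> \<open>For \<open>?c = 0\<close> the quadratic is affine in \<open>s\<close>, and
        this \<open>s\<close> gives it the value -1.\<close>
      then show False using quad[of "(?a + 1) / (2 * ?b)"] True by simp
    qed
    then show ?thesis using True by simp
  next
    case False
    then have "?c > 0" by (simp add: order_less_le)
    then show ?thesis using quad[of "?b / ?c"]
      by (simp add: field_simps power2_eq_square)
  qed
qed

text \<open>Cylinders determine a product measure, and a coordinatewise map pulls cylinders back to
  cylinders. Serves both the flips and the marginals of the noise measure.\<close>

lemma distr_PiM_UNIV_pointwise:
  assumes M: "\<And>i. prob_space (M i)" and N: "\<And>i. prob_space (N i)"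
    and h [measurable]: "\<And>i. h i \<in> measurable (M i) (N i)"
    and distr: "\<And>i. distr (M i) (N i) (h i) = N i"
  shows "distr (PiM UNIV M) (PiM UNIV N) (\<lambda>z i. h i (z i)) = PiM UNIV N"
proof -
  interpret product_prob_space N UNIV
    using N by (simp add: product_prob_space_def product_prob_space_axioms_def
        product_sigma_finite_def prob_space_imp_sigma_finite)
  have meas [measurable]: "(\<lambda>z i. h i (z i)) \<in> measurable (PiM UNIV M) (PiM UNIV N)"
    by (rule measurable_PiM_single') (auto simp: space_PiM PiE_iff intro: measurable_space[OF h])
  show ?thesis
  proof (rule PiM_eq)
    fix J :: "'a set" and F
    assume J: "finite J" and F: "\<And>j. j \<in> J \<Longrightarrow> F j \<in> sets (N j)"
    have "(\<lambda>z i. h i (z i)) -` prod_emb UNIV N J (Pi\<^sub>E J F) \<inter> space (PiM UNIV M)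
        = prod_emb UNIV M J (Pi\<^sub>E J (\<lambda>j. h j -` F j \<inter> space (M j)))"
      using measurable_space[OF h] by (auto simp: prod_emb_def space_PiM PiE_iff)
    then have "emeasure (distr (PiM UNIV M) (PiM UNIV N) (\<lambda>z i. h i (z i))) (prod_emb UNIV N J (Pi\<^sub>E J F))
        = emeasure (PiM UNIV M) (prod_emb UNIV M J (Pi\<^sub>E J (\<lambda>j. h j -` F j \<inter> space (M j))))"
      using J F by (subst emeasure_distr) (auto intro!: sets_PiM_I)
    also have "\<dots> = (\<Prod>j\<in>J. emeasure (M j) (h j -` F j \<inter> space (M j)))"
      using J F M by (subst Infinite_Product_Measure.emeasure_PiM_emb) auto
    also have "\<dots> = (\<Prod>j\<in>J. emeasure (N j) (F j))"
    proof (rule prod.cong)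
      fix j assume "j \<in> J"
      then show "emeasure (M j) (h j -` F j \<inter> space (M j)) = emeasure (N j) (F j)"
        using emeasure_distr[OF h F[OF \<open>j \<in> J\<close>]] by (simp add: distr)
    qed simp
    finally show "emeasure (distr (PiM UNIV M) (PiM UNIV N) (\<lambda>z i. h i (z i))) (prod_emb UNIV N J (Pi\<^sub>E J F))
        = (\<Prod>j\<in>J. emeasure (N j) (F j))" .
  qed simp
qed

section \<open>The uniform measure and coordinate flips\<close>

interpretation cube: prob_space cube
  unfolding cube_def by (intro prob_space_PiM measure_pmf.prob_space_axioms)

lemma space_cube [simp]: "space cube = UNIV"
  by (simp add: cube_def space_PiM PiE_def)

lemmas cube_integrable = bounded_measurable_integrable[OF cube.finite_measure_axioms]
lemmas cube_Cauchy_Schwarz = Cauchy_Schwarz_integral[OF cube.finite_measure_axioms]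

lemma measurable_coordinate [measurable]: "(\<lambda>w. w i) \<in> measurable cube (count_space UNIV)"
proof -
  have "(\<lambda>w. w i) \<in> measurable cube (measure_pmf (bernoulli_pmf (1/2)))"
    unfolding cube_def by (rule measurable_component_singleton) simp
  then show ?thesis by simp
qed

lemma abs_pm [simp]: "\<bar>pm b\<bar> = 1" and pm_not [simp]: "pm (\<not> b) = - pm b"
  and pm_squared [simp]: "pm b * pm b = 1"
  by (auto simp: pm_def)

lemma bounded_measurable_pm [bm_intros]:
  "f \<in> measurable cube (count_space UNIV) \<Longrightarrow> bounded_measurable cube (\<lambda>w. pm (f w))"
  by (auto simp: bounded_measurable_def)

lemma distr_flip: "distr cube cube (flip k) = cube"
proof -
  have eq: "flip k = (\<lambda>w i. (if i = k then Not else id) (w i))"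
    by (auto simp: flip_def fun_eq_iff)
  have "distr (measure_pmf (bernoulli_pmf (1/2))) (measure_pmf (bernoulli_pmf (1/2))) Not
      = measure_pmf (map_pmf Not (bernoulli_pmf (1/2)))"
    by (subst map_pmf_rep_eq) (auto intro!: distr_cong)
  also have "map_pmf Not (bernoulli_pmf (1/2)) = bernoulli_pmf (1/2)"
  proof (rule pmf_eqI)
    fix b :: bool
    have "pmf (map_pmf Not (bernoulli_pmf (1/2))) (\<not> (\<not> b)) = pmf (bernoulli_pmf (1/2)) (\<not> b)"
      by (rule pmf_map_inj') (auto simp: inj_def)
    then show "pmf (map_pmf Not (bernoulli_pmf (1/2))) b = pmf (bernoulli_pmf (1/2)) b"
      by (cases b) auto
  qed
  finally have "distr (measure_pmf (bernoulli_pmf (1/2))) (measure_pmf (bernoulli_pmf (1/2)))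
       (if i = k then Not else id) = measure_pmf (bernoulli_pmf (1/2))" for i
    by (auto simp: id_def distr_id2)
  then show ?thesis
    unfolding cube_def eq
    by (intro distr_PiM_UNIV_pointwise measure_pmf.prob_space_axioms) auto
qed

lemma measurable_flip [measurable]: "flip k \<in> measurable cube cube"
proof (subst (2) cube_def, rule measurable_PiM_single')
  show "(\<lambda>w. flip k w i) \<in> measurable cube (measure_pmf (bernoulli_pmf (1/2)))" for i
    unfolding flip_def by (cases "i = k") auto
qed (auto)

lemma integral_flip:
  fixes f :: "(nat \<Rightarrow> bool) \<Rightarrow> real"
  assumes "f \<in> borel_measurable cube"
  shows "(\<integral>w. f (flip k w) \<partial>cube) = (\<integral>w. f w \<partial>cube)"
  using integral_distr[OF measurable_flip assms, of k] by (simp add: distr_flip)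

text \<open>Stands in for independence and Fubini on \<open>cube\<close>: cross terms vanish because
  one measure-preserving flip reverses their sign.\<close>

lemma integral_flip_odd:
  fixes f :: "(nat \<Rightarrow> bool) \<Rightarrow> real"
  assumes "f \<in> borel_measurable cube" "\<And>w. f (flip k w) = - f w"
  shows "(\<integral>w. f w \<partial>cube) = 0"
  using integral_flip[OF assms(1), of k] assms(2) by simp

section \<open>Walsh functions\<close>

definition chi :: "nat set \<Rightarrow> (nat \<Rightarrow> bool) \<Rightarrow> real" where
  "chi S w = (\<Prod>i\<in>S. pm (w i))"

lemma bounded_measurable_chi [bm_intros]: "bounded_measurable cube (chi S)"
  unfolding chi_def by (intro bm_intros) measurable

lemma chi_empty [simp]: "chi {} w = 1"
  by (simp add: chi_def)

lemma chi_insert: "finite S \<Longrightarrow> i \<notin> S \<Longrightarrow> chi (insert i S) w = pm (w i) * chi S w"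
  by (simp add: chi_def)

lemma chi_flip_notin: "k \<notin> S \<Longrightarrow> chi S (flip k w) = chi S w"
  unfolding chi_def flip_def by (intro prod.cong) auto

lemma chi_flip_in:
  assumes "finite S" "k \<in> S"
  shows "chi S (flip k w) = - chi S w"
proof -
  define T where "T = S - {k}"
  have T: "finite T" "k \<notin> T" "S = insert k T" using assms by (auto simp: T_def)
  then have "chi (insert k T) (flip k w) = - chi (insert k T) w"
    by (simp add: chi_insert chi_flip_notin) (simp add: flip_def)
  then show ?thesis by (simp add: T)
qed

lemma chi_squared: "chi S w * chi S w = 1"
  by (simp add: chi_def prod.distrib[symmetric])

text \<open>Flipping a coordinate that lies in exactly one of the two sets reverses the sign of the
  product.\<close>

lemma chi_orthonormal:
  assumes "finite S" "finite T"
  shows "(\<integral>w. chi S w * chi T w \<partial>cube) = (if S = T then 1 else 0)"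
proof (cases "S = T")
  case True
  then show ?thesis using cube.prob_space by (simp add: chi_squared)
next
  case False
  then obtain k where k: "k \<in> S \<and> k \<notin> T \<or> k \<in> T \<and> k \<notin> S" by auto
  have "(\<integral>w. chi S w * chi T w \<partial>cube) = 0"
  proof (rule integral_flip_odd)
    show "chi S (flip k w) * chi T (flip k w) = - (chi S w * chi T w)" for w
      using k assms by (auto simp: chi_flip_in chi_flip_notin)
  qed (intro bounded_measurableD bm_intros)
  then show ?thesis using False by simp
qed

text \<open>Coefficients off \<open>Pow A\<close> are ignored. Keeping \<open>A\<close> explicit
  makes invariance under flips outside \<open>A\<close> immediate.\<close>

definition walsh :: "nat set \<Rightarrow> (nat set \<Rightarrow> real) \<Rightarrow> (nat \<Rightarrow> bool) \<Rightarrow> real" where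
  "walsh A a w = (\<Sum>S\<in>Pow A. a S * chi S w)"

lemma bounded_measurable_walsh [bm_intros]: "bounded_measurable cube (walsh A a)"
  unfolding walsh_def by (intro bm_intros)

lemma walsh_flip_notin: "k \<notin> A \<Longrightarrow> walsh A a (flip k w) = walsh A a w"
  unfolding walsh_def by (intro sum.cong) (auto intro: chi_flip_notin)

text \<open>Subsets are sorted by membership of \<open>x\<close>; both resulting polynomials are
  free of coordinate \<open>x\<close>, the form that inductions over coordinates need.\<close>

lemma walsh_insert:
  assumes "finite A" "x \<notin> A"
  shows "walsh (insert x A) a w = walsh A a w + pm (w x) * walsh A (\<lambda>S. a (insert x S)) w"
proof -
  have inj: "inj_on (insert x) (Pow A)"
    using assms by (intro inj_onI) (auto simp: insert_ident)
  have "Pow A \<inter> insert x ` Pow A = {}" using assms by auto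
  then have "walsh (insert x A) a w = walsh A a w + (\<Sum>S\<in>insert x ` Pow A. a S * chi S w)"
    unfolding walsh_def Pow_insert using assms by (subst sum.union_disjoint) auto
  also have "(\<Sum>S\<in>insert x ` Pow A. a S * chi S w) = (\<Sum>S\<in>Pow A. a (insert x S) * chi (insert x S) w)"
    using inj by (simp add: sum.reindex)
  also have "\<dots> = pm (w x) * walsh A (\<lambda>S. a (insert x S)) w"
    unfolding walsh_def sum_distrib_left
  proof (intro sum.cong)
    fix S assume "S \<in> Pow A"
    then have "finite S" "x \<notin> S" using assms by (auto intro: finite_subset)
    then show "a (insert x S) * chi (insert x S) w = pm (w x) * (a (insert x S) * chi S w)"
      by (simp add: chi_insert)
  qed simp
  finally show ?thesis .
qed

definition fourier :: "((nat \<Rightarrow> bool) \<Rightarrow> real) \<Rightarrow> nat set \<Rightarrow> real" where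
  "fourier F S = (\<integral>w. F w * chi S w \<partial>cube)"

lemma integral_mult_walsh:
  assumes "bounded_measurable cube F"
  shows "(\<integral>w. F w * walsh A a w \<partial>cube) = (\<Sum>S\<in>Pow A. a S * fourier F S)"
proof -
  have int: "integrable cube (\<lambda>w. F w * chi S w)" for S
    by (intro cube_integrable bm_intros assms)
  have "(\<integral>w. F w * walsh A a w \<partial>cube) = (\<integral>w. (\<Sum>S\<in>Pow A. a S * (F w * chi S w)) \<partial>cube)"
    unfolding walsh_def by (simp add: sum_distrib_left mult_ac)
  also have "\<dots> = (\<Sum>S\<in>Pow A. a S * fourier F S)"
    using int by (simp add: fourier_def)
  finally show ?thesis .
qed

lemma fourier_walsh:
  assumes "finite A" "S \<subseteq> A"
  shows "fourier (walsh A a) S = a S"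
proof -
  have "fourier (walsh A a) S = (\<integral>w. chi S w * walsh A a w \<partial>cube)"
    by (simp add: fourier_def mult.commute)
  also have "\<dots> = (\<Sum>T\<in>Pow A. a T * fourier (chi S) T)"
    by (intro integral_mult_walsh bm_intros)
  also have "\<dots> = (\<Sum>T\<in>Pow A. if T = S then a T else 0)"
    unfolding fourier_def using assms
    by (intro sum.cong) (auto simp: chi_orthonormal finite_subset)
  also have "\<dots> = a S" using assms by simp
  finally show ?thesis .
qed

lemma walsh_parseval:
  assumes "finite A"
  shows "(\<integral>w. (walsh A a w)\<^sup>2 \<partial>cube) = (\<Sum>S\<in>Pow A. (a S)\<^sup>2)"
proof -
  have "(\<integral>w. (walsh A a w)\<^sup>2 \<partial>cube) = (\<Sum>S\<in>Pow A. a S * fourier (walsh A a) S)"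
    unfolding power2_eq_square by (intro integral_mult_walsh bm_intros)
  also have "\<dots> = (\<Sum>S\<in>Pow A. (a S)\<^sup>2)"
    using assms by (intro sum.cong) (auto simp: fourier_walsh power2_eq_square)
  finally show ?thesis .
qed

text \<open>Completing the square. Taking \<open>a = fourier F\<close> yields Bessel's inequality,
  and the last sum shows that no other coefficients on \<open>A\<close> approximate better.\<close>

lemma integral_diff_walsh_squared:
  assumes F: "bounded_measurable cube F" and A: "finite A"
  shows "(\<integral>w. (F w - walsh A a w)\<^sup>2 \<partial>cube)
    = (\<integral>w. (F w)\<^sup>2 \<partial>cube) - (\<Sum>S\<in>Pow A. (fourier F S)\<^sup>2) + (\<Sum>S\<in>Pow A. (fourier F S - a S)\<^sup>2)"
proof -
  have int: "integrable cube (\<lambda>w. (F w)\<^sup>2)" "integrable cube (\<lambda>w. F w * walsh A a w)"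
    "integrable cube (\<lambda>w. (walsh A a w)\<^sup>2)"
    by (intro cube_integrable bm_intros F)+
  have "(\<integral>w. (F w - walsh A a w)\<^sup>2 \<partial>cube)
      = (\<integral>w. (F w)\<^sup>2 - 2 * (F w * walsh A a w) + (walsh A a w)\<^sup>2 \<partial>cube)"
    by (intro Bochner_Integration.integral_cong) (auto simp: power2_eq_square algebra_simps)
  also have "\<dots> = (\<integral>w. (F w)\<^sup>2 \<partial>cube) - 2 * (\<Sum>S\<in>Pow A. a S * fourier F S) + (\<Sum>S\<in>Pow A. (a S)\<^sup>2)"
    using int by (simp add: integral_mult_walsh[OF F] walsh_parseval[OF A])
  also have "\<dots> = (\<integral>w. (F w)\<^sup>2 \<partial>cube) - (\<Sum>S\<in>Pow A. (fourier F S)\<^sup>2) + (\<Sum>S\<in>Pow A. (fourier F S - a S)\<^sup>2)"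
    by (simp add: power2_diff sum.distrib sum_subtractf sum_distrib_left mult_ac)
  finally show ?thesis .
qed

lemma bessel:
  assumes F: "bounded_measurable cube F" and A: "finite A"
  shows "(\<Sum>S\<in>Pow A. (fourier F S)\<^sup>2) \<le> (\<integral>w. (F w)\<^sup>2 \<partial>cube)"
proof -
  have "0 \<le> (\<integral>w. (F w - walsh A (fourier F) w)\<^sup>2 \<partial>cube)" by simp
  then show ?thesis by (simp add: integral_diff_walsh_squared[OF F A])
qed

section \<open>Influences bound the low-degree spectrum\<close>

text \<open>Induction over coordinates: in \<open>Q + pm (w x) * R\<close> the factor
  \<open>R\<close> has degree one less, and the terms odd in \<open>pm (w x)\<close> integrate to
  0.\<close>

lemma bonami_hypercontractive:
  assumes "finite A" "\<And>S. S \<subseteq> A \<Longrightarrow> d < card S \<Longrightarrow> a S = 0"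
  shows "(\<integral>w. (walsh A a w) ^ 4 \<partial>cube) \<le> 9 ^ d * (\<integral>w. (walsh A a w)\<^sup>2 \<partial>cube)\<^sup>2"
  using assms
proof (induction A arbitrary: a d rule: finite_induct)
  case empty
  have "(1::real) \<le> 9 ^ d" by simp
  then have "a {} ^ 4 \<le> 9 ^ d * a {} ^ 4"
    using mult_right_mono[of 1 "9 ^ d :: real" "a {} ^ 4"] by simp
  then show ?case
    using cube.prob_space by (simp add: walsh_def flip: power_mult)
next
  case (insert x A)
  define Q where "Q = walsh A a"
  define R where "R = walsh A (\<lambda>S. a (insert x S))"
  have P: "walsh (insert x A) a w = Q w + pm (w x) * R w" for w
    using insert.hyps by (simp add: walsh_insert Q_def R_def)
  have Q_IH: "(\<integral>w. Q w ^ 4 \<partial>cube) \<le> 9 ^ d * (\<integral>w. (Q w)\<^sup>2 \<partial>cube)\<^sup>2"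
    unfolding Q_def by (rule insert.IH) (auto intro: insert.prems)
  show ?case
  \<comment> \<open>Degree 0 is separate because \<open>R\<close> has no smaller degree to fall to;
    there \<open>R\<close> vanishes.\<close>
  proof (cases d)
    case 0
    have "a (insert x S) = 0" if "S \<subseteq> A" for S
    proof (rule insert.prems)
      show "d < card (insert x S)"
        using that insert.hyps finite_subset[of S A] by (simp add: 0 card_gt_0_iff)
    qed (use that in auto)
    then have "R w = 0" for w
      by (auto simp: R_def walsh_def intro!: sum.neutral)
    then show ?thesis using Q_IH by (simp add: P)
  next
    case (Suc e)
    have R_IH: "(\<integral>w. R w ^ 4 \<partial>cube) \<le> 9 ^ e * (\<integral>w. (R w)\<^sup>2 \<partial>cube)\<^sup>2"
      unfolding R_def
    proof (rule insert.IH)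
      fix S assume S: "S \<subseteq> A" "e < card S"
      then have "finite S" "x \<notin> S" using insert.hyps finite_subset by auto
      with S show "a (insert x S) = 0"
        by (intro insert.prems) (auto simp: Suc)
    qed
    have bm: "bounded_measurable cube Q" "bounded_measurable cube R"
      "bounded_measurable cube (\<lambda>w. pm (w x))"
      unfolding Q_def R_def by (intro bm_intros; measurable)+
    have flip: "Q (flip x w) = Q w" "R (flip x w) = R w" "pm (flip x w x) = - pm (w x)" for w
      using insert.hyps by (simp_all add: Q_def R_def walsh_flip_notin) (simp add: flip_def)
    define q r where "q = (\<integral>w. (Q w)\<^sup>2 \<partial>cube)" and "r = (\<integral>w. (R w)\<^sup>2 \<partial>cube)"
    have q: "0 \<le> q" and r: "0 \<le> r" by (auto simp: q_def r_def)
    have int: "integrable cube (\<lambda>w. (Q w)\<^sup>2)" "integrable cube (\<lambda>w. (R w)\<^sup>2)"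
      "integrable cube (\<lambda>w. Q w ^ 4)" "integrable cube (\<lambda>w. R w ^ 4)"
      "integrable cube (\<lambda>w. (Q w)\<^sup>2 * (R w)\<^sup>2)"
      "integrable cube (\<lambda>w. pm (w x) * (Q w * R w))"
      "integrable cube (\<lambda>w. pm (w x) * (Q w ^ 3 * R w + Q w * R w ^ 3))"
      by (intro cube_integrable bm_intros bm)+
    have odd2: "(\<integral>w. pm (w x) * (Q w * R w) \<partial>cube) = 0"
      by (rule integral_flip_odd[where k = x]) (use int(6) in \<open>auto simp: flip\<close>)
    have odd4: "(\<integral>w. pm (w x) * (Q w ^ 3 * R w + Q w * R w ^ 3) \<partial>cube) = 0"
      by (rule integral_flip_odd[where k = x]) (use int(7) in \<open>auto simp: flip\<close>)
    have pm_sq: "(pm b)\<^sup>2 = 1" "pm b ^ 3 = pm b" "pm b ^ 4 = 1" for b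
      by (auto simp: pm_def)
    have "(\<integral>w. (Q w + pm (w x) * R w)\<^sup>2 \<partial>cube)
        = (\<integral>w. (Q w)\<^sup>2 + (R w)\<^sup>2 + 2 * (pm (w x) * (Q w * R w)) \<partial>cube)"
      by (intro Bochner_Integration.integral_cong)
         (auto simp: power2_sum power_mult_distrib pm_sq algebra_simps)
    also have "\<dots> = q + r" using int odd2 by (simp add: q_def r_def)
    finally have second: "(\<integral>w. (Q w + pm (w x) * R w)\<^sup>2 \<partial>cube) = q + r" .
    \<comment> \<open>Cauchy-Schwarz reduces the mixed moment to the two fourth moments; as
      \<open>d = Suc e\<close>, the product \<open>9 ^ d * 9 ^ e\<close> is the square of
      \<open>3 * 9 ^ e\<close>.\<close>
    have "(\<integral>w. (Q w)\<^sup>2 * (R w)\<^sup>2 \<partial>cube)\<^sup>2 \<le> (\<integral>w. ((Q w)\<^sup>2)\<^sup>2 \<partial>cube) * (\<integral>w. ((R w)\<^sup>2)\<^sup>2 \<partial>cube)"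
      by (intro cube_Cauchy_Schwarz bm_intros bm)
    also have "\<dots> = (\<integral>w. Q w ^ 4 \<partial>cube) * (\<integral>w. R w ^ 4 \<partial>cube)"
      by (simp flip: power_mult)
    also have "\<dots> \<le> (9 ^ d * q\<^sup>2) * (9 ^ e * r\<^sup>2)"
      using Q_IH R_IH unfolding q_def r_def by (intro mult_mono) auto
    also have "\<dots> = (3 * 9 ^ e * (q * r))\<^sup>2"
      by (simp add: Suc power2_eq_square)
    finally have "(\<integral>w. (Q w)\<^sup>2 * (R w)\<^sup>2 \<partial>cube) \<le> 3 * 9 ^ e * (q * r)"
      using q r by (rule_tac power2_le_imp_le) auto
    have "(\<integral>w. (Q w + pm (w x) * R w) ^ 4 \<partial>cube)
        = (\<integral>w. Q w ^ 4 + 6 * ((Q w)\<^sup>2 * (R w)\<^sup>2) + R w ^ 4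
            + 4 * (pm (w x) * (Q w ^ 3 * R w + Q w * R w ^ 3)) \<partial>cube)"
    proof (intro Bochner_Integration.integral_cong refl)
      fix w
      have "(Q w + s * R w) ^ 4 = Q w ^ 4 + 6 * s\<^sup>2 * ((Q w)\<^sup>2 * (R w)\<^sup>2) + s ^ 4 * R w ^ 4
            + 4 * (s * Q w ^ 3 * R w + s ^ 3 * Q w * R w ^ 3)" for s
        by (simp add: eval_nat_numeral algebra_simps)
      from this[of "pm (w x)"]
      show "(Q w + pm (w x) * R w) ^ 4 = Q w ^ 4 + 6 * ((Q w)\<^sup>2 * (R w)\<^sup>2) + R w ^ 4
            + 4 * (pm (w x) * (Q w ^ 3 * R w + Q w * R w ^ 3))"
        by (simp add: pm_sq algebra_simps)
    qed
    also have "\<dots> = (\<integral>w. Q w ^ 4 \<partial>cube) + 6 * (\<integral>w. (Q w)\<^sup>2 * (R w)\<^sup>2 \<partial>cube) + (\<integral>w. R w ^ 4 \<partial>cube)"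
      using int odd4 by simp
    \<comment> \<open>Here \<open>6 * 3 * 9 ^ e = 2 * 9 ^ d\<close> is exactly the cross coefficient
      in \<open>9 ^ d\<close> times the square of \<open>q + r\<close>; this explains the base
      9.\<close>
    also have "\<dots> \<le> 9 ^ d * q\<^sup>2 + 6 * (3 * 9 ^ e * (q * r)) + 9 ^ d * r\<^sup>2"
    proof -
      have "9 ^ e * r\<^sup>2 \<le> 9 ^ d * r\<^sup>2" by (simp add: Suc)
      then show ?thesis
        using Q_IH R_IH \<open>(\<integral>w. (Q w)\<^sup>2 * (R w)\<^sup>2 \<partial>cube) \<le> 3 * 9 ^ e * (q * r)\<close>
        unfolding q_def[symmetric] r_def[symmetric] by linarith
    qed
    also have "\<dots> = 9 ^ d * (q + r)\<^sup>2"
      by (simp add: Suc power2_sum algebra_simps)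
    finally show ?thesis unfolding P second .
  qed
qed

text \<open>Pair \<open>w\<close> with \<open>flip i w\<close>: the sign \<open>pm (w i)\<close>
  changes and \<open>a\<close> does not, so the pair cancels unless \<open>f\<close> changes. The
  surviving points form the event whose probability is the influence.\<close>

lemma influence_bounds_correlation:
  assumes f: "boolean_function f" and a: "bounded_measurable cube a"
    and indep: "\<And>w. a (flip i w) = a w" and c: "\<And>w. \<bar>a w\<bar> \<le> c"
  shows "(\<integral>w. pm (f w) * (pm (w i) * a w) \<partial>cube) \<le> c * influence f i"
proof -
  have [measurable]: "f \<in> measurable cube (count_space UNIV)"
    using f by (simp add: boolean_function_def)
  have [measurable]: "a \<in> borel_measurable cube" using a by auto
  define D where "D = {w \<in> space cube. f (flip i w) \<noteq> f w}"
  have D [measurable]: "D \<in> sets cube" unfolding D_def by measurable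
  let ?G = "\<lambda>w. pm (f w) * (pm (w i) * a w)"
  have bmG: "bounded_measurable cube ?G"
    by (intro bm_intros a) measurable
  have bmF: "bounded_measurable cube (\<lambda>w. ?G (flip i w))"
    by (rule bounded_measurable_compose[OF bmG measurable_flip])
  have "2 * (\<integral>w. ?G w \<partial>cube) = (\<integral>w. ?G w \<partial>cube) + (\<integral>w. ?G (flip i w) \<partial>cube)"
    using integral_flip[OF bounded_measurableD[OF bmG], of i] by simp
  also have "\<dots> = (\<integral>w. ?G w + ?G (flip i w) \<partial>cube)"
    using bmG bmF by (simp add: cube_integrable)
  also have "\<dots> \<le> (\<integral>w. 2 * c * indicator D w \<partial>cube)"
  proof (rule integral_mono)
    show "integrable cube (\<lambda>w. ?G w + ?G (flip i w))"
      by (intro cube_integrable bounded_measurable_add bmG bmF)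
    show "integrable cube (\<lambda>w. 2 * c * indicator D w)"
      by (intro cube_integrable bm_intros D)
    fix w
    have "\<bar>?G v\<bar> \<le> c" for v using c[of v] by (simp add: abs_mult)
    then have "?G w + ?G (flip i w) \<le> c + c" by (intro add_mono) (auto intro: order_trans[OF abs_ge_self])
    moreover have "?G w + ?G (flip i w) = 0" if "w \<notin> D"
    proof -
      have "f (flip i w) = f w" using that by (simp add: D_def)
      moreover have "flip i w i = (\<not> w i)" by (simp add: flip_def)
      ultimately show ?thesis by (simp add: indep)
    qed
    ultimately show "?G w + ?G (flip i w) \<le> 2 * c * indicator D w"
      by (auto split: split_indicator)
  qed
  also have "\<dots> = 2 * (c * influence f i)"
    using D by (simp add: influence_def D_def)
  finally show ?thesis by simp
qed

text \<open>For distinct \<open>i\<close> and \<open>j\<close>, flipping \<open>i\<close> reverses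
  the cross term, since neither \<open>b i\<close> nor \<open>b j\<close> depends on a coordinate in
  \<open>J\<close>. Nothing is assumed about Walsh expansions, so truncated functions
  qualify.\<close>

lemma integral_sum_signed_squared:
  assumes J: "finite J" and b: "\<And>i. i \<in> J \<Longrightarrow> bounded_measurable cube (b i)"
    and indep: "\<And>i j w. i \<in> J \<Longrightarrow> j \<in> J \<Longrightarrow> b i (flip j w) = b i w"
  shows "(\<integral>w. (\<Sum>i\<in>J. pm (w i) * b i w)\<^sup>2 \<partial>cube) = (\<Sum>i\<in>J. \<integral>w. (b i w)\<^sup>2 \<partial>cube)"
proof -
  have bm: "bounded_measurable cube (\<lambda>w. (pm (w i) * b i w) * (pm (w j) * b j w))"
    if "i \<in> J" "j \<in> J" for i j
    using that by (intro bm_intros b) (auto)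
  have inner: "(\<integral>w. (pm (w i) * b i w) * (pm (w j) * b j w) \<partial>cube)
      = (if i = j then \<integral>w. (b i w)\<^sup>2 \<partial>cube else 0)" if ij: "i \<in> J" "j \<in> J" for i j
  proof (cases "i = j")
    case True
    have "(pm (w i) * b i w) * (pm (w i) * b i w) = (b i w)\<^sup>2" for w
      using pm_squared[of "w i"] by (simp add: power2_eq_square pm_def)
    then show ?thesis using True by simp
  next
    case False
    then have "(\<integral>w. (pm (w i) * b i w) * (pm (w j) * b j w) \<partial>cube) = 0"
      using ij indep
      by (intro integral_flip_odd[where k = i] bounded_measurableD bm) (auto simp: flip_def)
    then show ?thesis using False by simp
  qed
  have "(\<integral>w. (\<Sum>i\<in>J. pm (w i) * b i w)\<^sup>2 \<partial>cube)
      = (\<integral>w. (\<Sum>i\<in>J. \<Sum>j\<in>J. (pm (w i) * b i w) * (pm (w j) * b j w)) \<partial>cube)"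
    by (simp add: power2_eq_square sum_product)
  also have "\<dots> = (\<Sum>i\<in>J. \<Sum>j\<in>J. \<integral>w. (pm (w i) * b i w) * (pm (w j) * b j w) \<partial>cube)"
    using bm by (simp add: cube_integrable)
  also have "\<dots> = (\<Sum>i\<in>J. \<Sum>j\<in>J. if i = j then \<integral>w. (b i w)\<^sup>2 \<partial>cube else 0)"
    by (intro sum.cong) (auto simp: inner)
  also have "\<dots> = (\<Sum>i\<in>J. \<integral>w. (b i w)\<^sup>2 \<partial>cube)"
    using J by simp
  finally show ?thesis .
qed

lemma sum_influence_squared_le:
  assumes "H f \<le> ennreal h" "0 \<le> h" "finite J"
  shows "(\<Sum>i\<in>J. (influence f i)\<^sup>2) \<le> h"
proof -
  have "ennreal (\<Sum>i\<in>J. (influence f i)\<^sup>2) = (\<Sum>i\<in>J. ennreal ((influence f i)\<^sup>2))"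
    by (simp add: sum_ennreal)
  also have "\<dots> \<le> H f"
    unfolding H_def using assms(3) by (intro sum_le_suminf) auto
  also note assms(1)
  finally show ?thesis
    using assms(2) by simp
qed

text \<open>
  Let \<open>g i\<close> collect the coefficients of the sets \<open>insert i T\<close>, so that the left-hand side is the
  correlation of \<open>f\<close> with \<open>\<Sum>i\<in>J. pm (w i) * g i w\<close>. Cut each \<open>g i\<close> at height \<open>t\<close> times its
  \<open>L\<^sup>2\<close> norm: the bounded part is controlled by the influences, and the remaining parts are
  small by hypercontractivity and mutually orthogonal after multiplication by \<open>pm (w i)\<close>, because
  no \<open>g i\<close> depends on the coordinates in \<open>J\<close>.
\<close>

lemma split_level_weight:
  assumes f: "boolean_function f" and h: "H f \<le> ennreal h" "0 \<le> h"
    and A: "finite A" "J \<subseteq> A" and t: "0 < t"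
  shows "(\<Sum>i\<in>J. \<Sum>T | T \<subseteq> A - J \<and> card T = d. (fourier (\<lambda>w. pm (f w)) (insert i T))\<^sup>2)
     \<le> (t * sqrt h + 3 ^ d / t)\<^sup>2"
proof -
  define F where "F = (\<lambda>w. pm (f w))"
  have fm [measurable]: "f \<in> measurable cube (count_space UNIV)"
    using f by (simp add: boolean_function_def)
  have bmF: "bounded_measurable cube F" unfolding F_def by (intro bm_intros fm)
  have fin: "finite J" "finite (A - J)" using A finite_subset by auto
  define c where "c i T = (if card T = d then fourier F (insert i T) else 0)" for i T
  define g where "g i = walsh (A - J) (c i)" for i
  define n where "n i = (\<integral>w. (g i w)\<^sup>2 \<partial>cube)" for i
  define G where "G = (\<Sum>i\<in>J. n i)"
  have n0: "0 \<le> n i" for i by (simp add: n_def)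
  then have G0: "0 \<le> G" by (simp add: G_def sum_nonneg)
  have bmg: "bounded_measurable cube (g i)" for i unfolding g_def by (intro bm_intros)
  have [measurable]: "g i \<in> borel_measurable cube" for i using bmg by auto
  have g_flip: "g i (flip j w) = g i w" if "j \<in> J" for i j w
    using that by (simp add: g_def walsh_flip_notin)
  have n_eq: "n i = (\<Sum>T\<in>Pow (A - J). (c i T)\<^sup>2)" for i
    unfolding n_def g_def using fin by (rule_tac walsh_parseval)
  have n_sum: "n i = (\<Sum>T | T \<subseteq> A - J \<and> card T = d. (fourier F (insert i T))\<^sup>2)" for i
  proof -
    have "n i = (\<Sum>T\<in>Pow (A - J). if card T = d then (fourier F (insert i T))\<^sup>2 else 0)"
      unfolding n_eq c_def by (intro sum.cong) auto
    also have "\<dots> = (\<Sum>T\<in>{T \<in> Pow (A - J). card T = d}. (fourier F (insert i T))\<^sup>2)"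
      using fin by (intro sum.inter_filter[symmetric]) simp
    finally show ?thesis by (simp add: Pow_def)
  qed
  \<comment> \<open>The coefficients of \<open>g i\<close> are copied from \<open>F\<close>, so the
    correlation equals the squared norm \<open>n i\<close>; bounding correlations therefore bounds
    spectral weight.\<close>
  have corr: "(\<integral>w. F w * (pm (w i) * g i w) \<partial>cube) = n i" if "i \<in> J" for i
  proof -
    have "(\<integral>w. F w * (pm (w i) * g i w) \<partial>cube) = (\<integral>w. (F w * pm (w i)) * walsh (A - J) (c i) w \<partial>cube)"
      by (simp add: g_def mult_ac)
    also have "\<dots> = (\<Sum>T\<in>Pow (A - J). c i T * fourier (\<lambda>w. F w * pm (w i)) T)"
      by (intro integral_mult_walsh bm_intros bmF) measurable
    also have "\<dots> = n i"
      unfolding n_eq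
    proof (intro sum.cong refl)
      fix T assume "T \<in> Pow (A - J)"
      then have "finite T" "i \<notin> T" using that fin finite_subset by auto
      then have "fourier (\<lambda>w. F w * pm (w i)) T = fourier F (insert i T)"
        by (simp add: fourier_def chi_insert mult_ac)
      then show "c i T * fourier (\<lambda>w. F w * pm (w i)) T = (c i T)\<^sup>2"
        by (simp add: c_def power2_eq_square)
    qed
    finally show ?thesis .
  qed
  define s where "s i w = (if \<bar>g i w\<bar> \<le> t * sqrt (n i) then g i w else 0)" for i w
  define b where "b i w = (if \<bar>g i w\<bar> \<le> t * sqrt (n i) then 0 else g i w)" for i w
  have gsb: "g i w = s i w + b i w" for i w by (simp add: s_def b_def)
  have bms: "bounded_measurable cube (s i)" for i
    using bmg[of i] unfolding bounded_measurable_def s_def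
    by (auto intro: order_trans[OF abs_ge_zero])
  have bmb: "bounded_measurable cube (b i)" for i
    using bmg[of i] unfolding bounded_measurable_def b_def
    by (auto intro: order_trans[OF abs_ge_zero])
  have bmpm: "bounded_measurable cube (\<lambda>w. pm (w i))" for i by (intro bm_intros) measurable
  have small: "(\<integral>w. F w * (pm (w i) * s i w) \<partial>cube) \<le> t * sqrt (n i) * influence f i" if "i \<in> J" for i
    unfolding F_def using that t n0
    by (intro influence_bounds_correlation f bms) (auto simp: s_def g_flip)
  \<comment> \<open>Where \<open>b i\<close> is nonzero, \<open>g i\<close> exceeds
    \<open>t * sqrt (n i)\<close> in absolute value, so
    \<open>t\<^sup>2 * n i * (b i w)\<^sup>2\<close> is at most the fourth power of
    \<open>g i w\<close>, which Bonami's inequality controls. The case \<open>n i = 0\<close> is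
    split off because \<open>n i\<close> is cancelled at the end.\<close>
  have large: "(\<integral>w. (b i w)\<^sup>2 \<partial>cube) \<le> 9 ^ d / t\<^sup>2 * n i" for i
  proof (cases "n i = 0")
    case True
    have "(\<integral>w. (b i w)\<^sup>2 \<partial>cube) \<le> (\<integral>w. (g i w)\<^sup>2 \<partial>cube)"
      by (intro integral_mono cube_integrable bm_intros bmb bmg) (simp add: b_def)
    then show ?thesis using True by (simp add: n_def[symmetric])
  next
    case False
    then have pos: "0 < n i" using n0[of i] by simp
    have "t\<^sup>2 * n i * (\<integral>w. (b i w)\<^sup>2 \<partial>cube) = (\<integral>w. t\<^sup>2 * n i * (b i w)\<^sup>2 \<partial>cube)"
      by simp
    also have "\<dots> \<le> (\<integral>w. (g i w) ^ 4 \<partial>cube)"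
    proof (intro integral_mono cube_integrable bm_intros bmb bmg)
      fix w
      show "t\<^sup>2 * n i * (b i w)\<^sup>2 \<le> (g i w) ^ 4"
      proof (cases "\<bar>g i w\<bar> \<le> t * sqrt (n i)")
        case False
        then have "(t * sqrt (n i))\<^sup>2 \<le> \<bar>g i w\<bar>\<^sup>2"
          using t n0[of i] by (intro power_mono) auto
        then have "t\<^sup>2 * n i \<le> (g i w)\<^sup>2" using n0[of i] by (simp add: power_mult_distrib)
        then have "t\<^sup>2 * n i * (g i w)\<^sup>2 \<le> (g i w)\<^sup>2 * (g i w)\<^sup>2" by (intro mult_right_mono) auto
        then show ?thesis using False by (simp add: b_def flip: power_add)
      qed (simp add: b_def)
    qed
    also have "\<dots> \<le> 9 ^ d * (n i)\<^sup>2"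
      unfolding n_def g_def by (intro bonami_hypercontractive fin) (simp add: c_def)
    finally have "t\<^sup>2 * n i * (\<integral>w. (b i w)\<^sup>2 \<partial>cube) \<le> 9 ^ d * (n i)\<^sup>2" .
    then show ?thesis using pos t by (simp add: field_simps power2_eq_square)
  qed
  have "G = (\<Sum>i\<in>J. \<integral>w. F w * (pm (w i) * g i w) \<partial>cube)"
    by (simp add: G_def corr)
  also have "\<dots> = (\<Sum>i\<in>J. (\<integral>w. F w * (pm (w i) * s i w) \<partial>cube) + (\<integral>w. F w * (pm (w i) * b i w) \<partial>cube))"
  proof (intro sum.cong refl)
    fix i
    have "integrable cube (\<lambda>w. F w * (pm (w i) * s i w))" "integrable cube (\<lambda>w. F w * (pm (w i) * b i w))"
      by (intro cube_integrable bm_intros bmF bms bmb bmpm)+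
    then show "(\<integral>w. F w * (pm (w i) * g i w) \<partial>cube)
      = (\<integral>w. F w * (pm (w i) * s i w) \<partial>cube) + (\<integral>w. F w * (pm (w i) * b i w) \<partial>cube)"
      by (simp add: gsb distrib_left)
  qed
  also have "\<dots> = (\<Sum>i\<in>J. \<integral>w. F w * (pm (w i) * s i w) \<partial>cube) + (\<Sum>i\<in>J. \<integral>w. F w * (pm (w i) * b i w) \<partial>cube)"
    by (simp add: sum.distrib)
  finally have G_split: "G = \<dots>" .
  have "(\<Sum>i\<in>J. \<integral>w. F w * (pm (w i) * s i w) \<partial>cube) \<le> (\<Sum>i\<in>J. t * sqrt (n i) * influence f i)"
    by (intro sum_mono small)
  also have "\<dots> = t * (\<Sum>i\<in>J. \<bar>sqrt (n i)\<bar> * \<bar>influence f i\<bar>)"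
    using n0 by (simp add: sum_distrib_left mult_ac influence_def)
  also have "\<dots> \<le> t * (L2_set (\<lambda>i. sqrt (n i)) J * L2_set (influence f) J)"
    using t by (intro mult_left_mono L2_set_mult_ineq) auto
  also have "\<dots> \<le> t * (sqrt G * sqrt h)"
  proof -
    have "L2_set (\<lambda>i. sqrt (n i)) J = sqrt G" using n0 by (simp add: L2_set_def G_def)
    moreover have "L2_set (influence f) J \<le> sqrt h"
      using sum_influence_squared_le[OF h fin(1)] by (simp add: L2_set_def)
    ultimately show ?thesis using t G0 by (simp add: mult_left_mono)
  qed
  finally have S_le: "(\<Sum>i\<in>J. \<integral>w. F w * (pm (w i) * s i w) \<partial>cube) \<le> t * (sqrt G * sqrt h)" .
  \<comment> \<open>The sum moves inside before Cauchy-Schwarz is applied: termwise estimates would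
    produce a sum of \<open>sqrt (n i)\<close>, whereas orthogonality gives
    \<open>sqrt G\<close>.\<close>
  have "(\<Sum>i\<in>J. \<integral>w. F w * (pm (w i) * b i w) \<partial>cube) = (\<integral>w. F w * (\<Sum>i\<in>J. pm (w i) * b i w) \<partial>cube)"
    (is "?B = _")
  proof -
    have "integrable cube (\<lambda>w. F w * (pm (w i) * b i w))" for i
      by (intro cube_integrable bm_intros bmF bmb bmpm)
    then show ?thesis by (simp add: sum_distrib_left)
  qed
  then have "?B\<^sup>2 \<le> (\<integral>w. (F w)\<^sup>2 \<partial>cube) * (\<integral>w. (\<Sum>i\<in>J. pm (w i) * b i w)\<^sup>2 \<partial>cube)"
    by (simp only:) (intro cube_Cauchy_Schwarz bm_intros bmF bmb bmpm)
  also have "\<dots> = (\<Sum>i\<in>J. \<integral>w. (b i w)\<^sup>2 \<partial>cube)"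
  proof -
    have "(\<integral>w. (F w)\<^sup>2 \<partial>cube) = 1"
      using cube.prob_space by (simp add: F_def power2_eq_square)
    moreover have "(\<integral>w. (\<Sum>i\<in>J. pm (w i) * b i w)\<^sup>2 \<partial>cube) = (\<Sum>i\<in>J. \<integral>w. (b i w)\<^sup>2 \<partial>cube)"
      by (intro integral_sum_signed_squared fin bmb) (simp add: b_def g_flip)
    ultimately show ?thesis by simp
  qed
  also have "\<dots> \<le> (\<Sum>i\<in>J. 9 ^ d / t\<^sup>2 * n i)"
    by (intro sum_mono large)
  also have "\<dots> = (3 ^ d / t * sqrt G)\<^sup>2"
  proof -
    have "((3::real) ^ d)\<^sup>2 = 9 ^ d" by (simp add: power2_eq_square flip: power_mult_distrib)
    then show ?thesis
      using G0 by (simp only: sum_distrib_left[symmetric] G_def[symmetric])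
         (simp add: power_mult_distrib power_divide)
  qed
  finally have "?B \<le> 3 ^ d / t * sqrt G"
    using t G0 by (rule_tac power2_le_imp_le) auto
  \<comment> \<open>Both parts are proportional to \<open>sqrt G\<close>, so one factor cancels and
    the remaining bound is free of \<open>G\<close>.\<close>
  with S_le G_split have "G \<le> (t * sqrt h + 3 ^ d / t) * sqrt G"
    by (simp add: algebra_simps)
  then have le: "sqrt G * sqrt G \<le> (t * sqrt h + 3 ^ d / t) * sqrt G"
    using G0 by simp
  have nonneg: "0 \<le> t * sqrt h + 3 ^ d / t" using t h by simp
  have "sqrt G \<le> t * sqrt h + 3 ^ d / t"
  proof (cases "G = 0")
    case False
    then have "0 < sqrt G" using G0 by simp
    then show ?thesis using le by (rule_tac mult_right_le_imp_le)
  qed (use nonneg in simp)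
  then have "(sqrt G)\<^sup>2 \<le> (t * sqrt h + 3 ^ d / t)\<^sup>2"
    using G0 by (intro power_mono) auto
  then show ?thesis
    using G0 by (simp add: G_def n_sum F_def)
qed

text \<open>
  Averaging over \<open>J\<close>: a set \<open>S\<close> of size \<open>Suc d\<close> meets a fraction of at least \<open>2 ^ - Suc d\<close> of
  all \<open>J \<subseteq> A\<close> in exactly one prescribed point.
\<close>

lemma sum_over_splits:
  fixes \<phi> :: "nat set \<Rightarrow> real"
  assumes A: "finite A" and \<phi>: "\<And>S. 0 \<le> \<phi> S"
    and B: "\<And>J. J \<subseteq> A \<Longrightarrow> (\<Sum>i\<in>J. \<Sum>T | T \<subseteq> A - J \<and> card T = d. \<phi> (insert i T)) \<le> B"
  shows "(\<Sum>S | S \<subseteq> A \<and> card S = Suc d. \<phi> S) \<le> 2 ^ Suc d * B"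
proof -
  let ?X = "{S. S \<subseteq> A \<and> card S = Suc d}"
  have finS: "finite S" if "S \<subseteq> A" for S using that A finite_subset by auto
  have fin: "finite {T. T \<subseteq> A' \<and> P T}" if "A' \<subseteq> A" for A' P
    by (rule finite_subset[of _ "Pow A"]) (use that A in auto)
  \<comment> \<open>The factor counts the sets \<open>K\<close> disjoint from \<open>S\<close>; each
    will supply a split \<open>J = insert m K\<close> that meets \<open>S\<close> only in a chosen
    point \<open>m\<close>.\<close>
  have "(\<Sum>S\<in>?X. \<phi> S * 2 ^ (card A - Suc d)) = (\<Sum>S\<in>?X. \<Sum>K\<in>Pow (A - S). \<phi> S)"
  proof (intro sum.cong refl)
    fix S assume S: "S \<in> ?X"
    then have "card (A - S) = card A - Suc d" using finS by (auto simp: card_Diff_subset)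
    then show "\<phi> S * 2 ^ (card A - Suc d) = (\<Sum>K\<in>Pow (A - S). \<phi> S)"
      using A by (simp add: card_Pow)
  qed
  also have "\<dots> = (\<Sum>(S, K)\<in>Sigma ?X (\<lambda>S. Pow (A - S)). \<phi> S)"
    using A fin by (intro sum.Sigma) auto
  also have "\<dots> \<le> (\<Sum>(J, i, T)\<in>Sigma (Pow A) (\<lambda>J. J \<times> {T. T \<subseteq> A - J \<and> card T = d}). \<phi> (insert i T))"
  \<comment> \<open>The map recovers the pair \<open>(S, K)\<close> from a split. One preimage per
    pair suffices, because the terms left over are nonnegative.\<close>
  proof (rule sum_le_included[where i = "\<lambda>(J, i, T). (insert i T, J - {i})"])
    show "finite (Sigma ?X (\<lambda>S. Pow (A - S)))"
      using A fin by (intro finite_SigmaI) auto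
    show "finite (Sigma (Pow A) (\<lambda>J. J \<times> {T. T \<subseteq> A - J \<and> card T = d}))"
      using A fin finS by (intro finite_SigmaI finite_cartesian_product) auto
    show "\<forall>x\<in>Sigma ?X (\<lambda>S. Pow (A - S)).
        \<exists>y\<in>Sigma (Pow A) (\<lambda>J. J \<times> {T. T \<subseteq> A - J \<and> card T = d}).
          (case y of (J, i, T) \<Rightarrow> (insert i T, J - {i})) = x \<and>
          (case x of (S, K) \<Rightarrow> \<phi> S) \<le> (case y of (J, i, T) \<Rightarrow> \<phi> (insert i T))"
    proof safe
      fix S K assume S: "S \<subseteq> A" "card S = Suc d" and K: "K \<subseteq> A - S"
      obtain m where m: "m \<in> S" using S(2) by (metis all_not_in_conv card.empty nat.simps(3))
      have "card (S - {m}) = d" using S m finS by simp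
      then show "\<exists>y\<in>Sigma (Pow A) (\<lambda>J. J \<times> {T. T \<subseteq> A - J \<and> card T = d}).
          (case y of (J, i, T) \<Rightarrow> (insert i T, J - {i})) = (S, K) \<and>
          \<phi> S \<le> (case y of (J, i, T) \<Rightarrow> \<phi> (insert i T))"
        using S m K by (intro bexI[of _ "(insert m K, m, S - {m})"]) (auto simp: insert_absorb)
    qed
  qed (use \<phi> in auto)
  also have "\<dots> = (\<Sum>J\<in>Pow A. \<Sum>(i, T)\<in>J \<times> {T. T \<subseteq> A - J \<and> card T = d}. \<phi> (insert i T))"
    using A fin finS by (intro sum.Sigma[symmetric]) auto
  also have "\<dots> = (\<Sum>J\<in>Pow A. \<Sum>i\<in>J. \<Sum>T | T \<subseteq> A - J \<and> card T = d. \<phi> (insert i T))"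
    by (simp add: sum.cartesian_product)
  also have "\<dots> \<le> (\<Sum>J\<in>Pow A. B)"
    by (intro sum_mono B) auto
  also have "\<dots> = 2 ^ card A * B" using A by (simp add: card_Pow)
  finally have le: "(\<Sum>S\<in>?X. \<phi> S) * 2 ^ (card A - Suc d) \<le> 2 ^ card A * B"
    by (simp add: sum_distrib_right)
  show ?thesis
  \<comment> \<open>If \<open>A\<close> has fewer than \<open>Suc d\<close> elements, the truncated
    subtraction in the exponent spoils the count; in that case no \<open>S\<close> exists.\<close>
  proof (cases "?X = {}")
    case True
    have "0 \<le> B" using B[of "{}"] by simp
    then show ?thesis unfolding True by simp
  next
    case False
    then obtain S where "S \<subseteq> A" "card S = Suc d" by blast
    then have "Suc d \<le> card A" using card_mono[OF A] by metis
    then have "(2::real) ^ card A = 2 ^ (card A - Suc d) * 2 ^ Suc d"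
      by (simp only: power_add[symmetric]) simp
    with le have "(\<Sum>S\<in>?X. \<phi> S) * 2 ^ (card A - Suc d) \<le> (2 ^ Suc d * B) * 2 ^ (card A - Suc d)"
      by (simp add: mult_ac)
    then show ?thesis by (rule mult_right_le_imp_le) simp
  qed
qed

lemma level_weight_le:
  assumes f: "boolean_function f" and h: "H f \<le> ennreal h" "0 < h" and A: "finite A"
  shows "(\<Sum>S | S \<subseteq> A \<and> card S = Suc d. (fourier (\<lambda>w. pm (f w)) S)\<^sup>2) \<le> 2 ^ Suc d * ((1 + 3 ^ d)\<^sup>2 * sqrt h)"
proof (rule sum_over_splits[OF A])
  fix J assume J: "J \<subseteq> A"
  \<comment> \<open>With threshold \<open>t = 1 / r\<close> the two errors become \<open>r\<close>
    and \<open>3 ^ d * r\<close>.\<close>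
  define r where "r = sqrt (sqrt h)"
  have r: "0 < r" "sqrt h = r * r" using h by (auto simp: r_def)
  have "(1 / r * sqrt h + 3 ^ d / (1 / r))\<^sup>2 = ((1 + 3 ^ d) * r)\<^sup>2"
    using r by (simp add: algebra_simps)
  also have "\<dots> = (1 + 3 ^ d)\<^sup>2 * sqrt h" by (simp add: r(2) power2_eq_square)
  finally show "(\<Sum>i\<in>J. \<Sum>T | T \<subseteq> A - J \<and> card T = d. (fourier (\<lambda>w. pm (f w)) (insert i T))\<^sup>2)
      \<le> (1 + 3 ^ d)\<^sup>2 * sqrt h"
    using split_level_weight[OF f h(1) _ A J, of "1 / r" d] r h by simp
qed simp

section \<open>Density of Walsh polynomials\<close>

lemma walsh_superset:
  assumes "finite B" "A \<subseteq> B"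
  shows "walsh A a w = walsh B (\<lambda>S. if S \<subseteq> A then a S else 0) w"
  unfolding walsh_def using assms by (intro sum.mono_neutral_cong_left) auto

lemma walsh_add: "walsh A a w + walsh A b w = walsh A (\<lambda>S. a S + b S) w"
  by (simp add: walsh_def sum.distrib distrib_right)

lemma walsh_cmult: "c * walsh A a w = walsh A (\<lambda>S. c * a S) w"
  by (simp add: walsh_def sum_distrib_left mult_ac)

text \<open>Any function of one bit is affine in its sign; multiplying out gives a Walsh polynomial.
  Indicators of cylinders are the intended case.\<close>

lemma prod_coordinates_eq_walsh:
  fixes \<phi> :: "nat \<Rightarrow> bool \<Rightarrow> real"
  assumes "finite J"
  shows "\<exists>a. \<forall>w. (\<Prod>i\<in>J. \<phi> i (w i)) = walsh J a w"
  using assms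
proof (induction J rule: finite_induct)
  case empty
  show ?case by (rule exI[of _ "\<lambda>_. 1"]) (simp add: walsh_def)
next
  case (insert x J)
  then obtain a where a: "\<And>w. (\<Prod>i\<in>J. \<phi> i (w i)) = walsh J a w" by auto
  define \<alpha> \<beta> where "\<alpha> = (\<phi> x True + \<phi> x False) / 2" and "\<beta> = (\<phi> x True - \<phi> x False) / 2"
  have \<phi>: "\<phi> x b = \<alpha> + pm b * \<beta>" for b
    by (cases b) (auto simp: \<alpha>_def \<beta>_def pm_def field_simps)
  define a' where "a' S = (if x \<in> S then \<beta> * a (S - {x}) else \<alpha> * a S)" for S
  have "(\<Prod>i\<in>insert x J. \<phi> i (w i)) = walsh (insert x J) a' w" for w
  proof -
    have "walsh J a' w = \<alpha> * walsh J a w"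
      unfolding walsh_def sum_distrib_left using insert.hyps
      by (intro sum.cong refl) (auto simp: a'_def)
    moreover have "walsh J (\<lambda>S. a' (insert x S)) w = \<beta> * walsh J a w"
      unfolding walsh_def sum_distrib_left
    proof (intro sum.cong refl)
      fix S assume "S \<in> Pow J"
      then have "insert x S - {x} = S" using insert.hyps by auto
      then show "a' (insert x S) * chi S w = \<beta> * (a S * chi S w)" by (simp add: a'_def)
    qed
    ultimately show ?thesis
      using insert.hyps by (simp add: a walsh_insert \<phi> algebra_simps)
  qed
  then show ?case by blast
qed

text \<open>Membership of a bounded function in the L2 closure of the Walsh polynomials; boundedness
  guarantees that the squared distances are integrable.\<close>

definition walsh_approximable :: "((nat \<Rightarrow> bool) \<Rightarrow> real) \<Rightarrow> bool" where
  "walsh_approximable F \<longleftrightarrow> bounded_measurable cube F \<and>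
     (\<forall>e>0. \<exists>A a. finite A \<and> (\<integral>w. (F w - walsh A a w)\<^sup>2 \<partial>cube) < e)"

lemma walsh_approximable_walsh:
  assumes "finite A" shows "walsh_approximable (walsh A a)"
  unfolding walsh_approximable_def
proof (intro conjI allI impI bm_intros)
  fix e :: real assume "0 < e"
  then show "\<exists>B b. finite B \<and> (\<integral>w. (walsh A a w - walsh B b w)\<^sup>2 \<partial>cube) < e"
    using assms by (intro exI[of _ A] exI[of _ a]) simp
qed

lemma walsh_approximable_const: "walsh_approximable (\<lambda>_. c)"
proof -
  have "(\<lambda>_. c) = walsh {} (\<lambda>_. c)" by (auto simp: walsh_def)
  then show ?thesis using walsh_approximable_walsh[of "{}" "\<lambda>_. c"] by simp
qed

text \<open>A substitute for Minkowski's inequality; its factors 2 account for the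
  \<open>e / 4\<close> in the closure proofs.\<close>

lemma integral_sum_squared_le:
  assumes "bounded_measurable cube U" "bounded_measurable cube V"
  shows "(\<integral>w. (U w + V w)\<^sup>2 \<partial>cube) \<le> 2 * (\<integral>w. (U w)\<^sup>2 \<partial>cube) + 2 * (\<integral>w. (V w)\<^sup>2 \<partial>cube)"
proof -
  have int: "integrable cube (\<lambda>w. (U w)\<^sup>2)" "integrable cube (\<lambda>w. (V w)\<^sup>2)"
    by (intro cube_integrable bm_intros assms)+
  have "(\<integral>w. (U w + V w)\<^sup>2 \<partial>cube) \<le> (\<integral>w. 2 * (U w)\<^sup>2 + 2 * (V w)\<^sup>2 \<partial>cube)"
  proof (intro integral_mono cube_integrable bm_intros assms)
    fix w show "(U w + V w)\<^sup>2 \<le> 2 * (U w)\<^sup>2 + 2 * (V w)\<^sup>2"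
      using zero_le_power2[of "U w - V w"] by (simp add: power2_sum power2_diff)
  qed
  also have "\<dots> = 2 * (\<integral>w. (U w)\<^sup>2 \<partial>cube) + 2 * (\<integral>w. (V w)\<^sup>2 \<partial>cube)"
    using int by simp
  finally show ?thesis .
qed

lemma walsh_approximable_limit:
  assumes F: "bounded_measurable cube F"
    and G: "\<And>e. 0 < e \<Longrightarrow> \<exists>G. walsh_approximable G \<and> (\<integral>w. (F w - G w)\<^sup>2 \<partial>cube) < e"
  shows "walsh_approximable F"
  unfolding walsh_approximable_def
proof (intro conjI allI impI F)
  fix e :: real assume e: "0 < e"
  obtain G where G: "walsh_approximable G" "(\<integral>w. (F w - G w)\<^sup>2 \<partial>cube) < e / 4"
    using G[of "e / 4"] e by auto
  obtain A a where A: "finite A" "(\<integral>w. (G w - walsh A a w)\<^sup>2 \<partial>cube) < e / 4"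
    using G(1) e unfolding walsh_approximable_def by (meson divide_pos_pos zero_less_numeral)
  have bmG: "bounded_measurable cube G" using G(1) by (simp add: walsh_approximable_def)
  have "(\<integral>w. ((F w - G w) + (G w - walsh A a w))\<^sup>2 \<partial>cube)
      \<le> 2 * (\<integral>w. (F w - G w)\<^sup>2 \<partial>cube) + 2 * (\<integral>w. (G w - walsh A a w)\<^sup>2 \<partial>cube)"
    by (intro integral_sum_squared_le bm_intros F bmG)
  then have "(\<integral>w. (F w - walsh A a w)\<^sup>2 \<partial>cube) < e" using G(2) A(2) by simp
  then show "\<exists>A a. finite A \<and> (\<integral>w. (F w - walsh A a w)\<^sup>2 \<partial>cube) < e"
    using A(1) by blast
qed

lemma walsh_approximable_add:
  assumes F: "walsh_approximable F" and G: "walsh_approximable G"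
  shows "walsh_approximable (\<lambda>w. F w + G w)"
  unfolding walsh_approximable_def
proof (intro conjI allI impI)
  have bm: "bounded_measurable cube F" "bounded_measurable cube G"
    using F G by (auto simp: walsh_approximable_def)
  then show "bounded_measurable cube (\<lambda>w. F w + G w)" by (intro bm_intros)
  fix e :: real assume e: "0 < e"
  then have "0 < e / 4" by simp
  then obtain A a B b where A: "finite A" "(\<integral>w. (F w - walsh A a w)\<^sup>2 \<partial>cube) < e / 4"
    and B: "finite B" "(\<integral>w. (G w - walsh B b w)\<^sup>2 \<partial>cube) < e / 4"
    using F G unfolding walsh_approximable_def by meson
  define c where "c S = (if S \<subseteq> A then a S else 0) + (if S \<subseteq> B then b S else 0)" for S
  have c: "walsh A a w + walsh B b w = walsh (A \<union> B) c w" for w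
    using A B unfolding c_def walsh_add[symmetric]
    by (intro arg_cong2[where f = "(+)"] walsh_superset) auto
  have "(\<integral>w. (F w + G w - walsh (A \<union> B) c w)\<^sup>2 \<partial>cube)
      = (\<integral>w. ((F w - walsh A a w) + (G w - walsh B b w))\<^sup>2 \<partial>cube)"
    by (simp add: c[symmetric] algebra_simps)
  also have "\<dots> \<le> 2 * (\<integral>w. (F w - walsh A a w)\<^sup>2 \<partial>cube) + 2 * (\<integral>w. (G w - walsh B b w)\<^sup>2 \<partial>cube)"
    by (intro integral_sum_squared_le bm_intros bm)
  also have "\<dots> < e" using A(2) B(2) by simp
  finally show "\<exists>A a. finite A \<and> (\<integral>w. (F w + G w - walsh A a w)\<^sup>2 \<partial>cube) < e"
    using A(1) B(1) by blast
qed

lemma walsh_approximable_uminus: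
  assumes F: "walsh_approximable F"
  shows "walsh_approximable (\<lambda>w. - F w)"
  unfolding walsh_approximable_def
proof (intro conjI allI impI)
  show "bounded_measurable cube (\<lambda>w. - F w)"
    using F by (auto simp: walsh_approximable_def intro: bm_intros)
  fix e :: real assume "0 < e"
  then obtain A a where A: "finite A" "(\<integral>w. (F w - walsh A a w)\<^sup>2 \<partial>cube) < e"
    using F unfolding walsh_approximable_def by meson
  have "(- F w - walsh A (\<lambda>S. - 1 * a S) w)\<^sup>2 = (F w - walsh A a w)\<^sup>2" for w
    unfolding walsh_cmult[symmetric] by (simp add: power2_eq_square algebra_simps)
  then show "\<exists>A a. finite A \<and> (\<integral>w. (- F w - walsh A a w)\<^sup>2 \<partial>cube) < e"
    using A by (intro exI[of _ A] exI[of _ "\<lambda>S. - 1 * a S"]) simp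
qed

lemma walsh_approximable_sum:
  "(\<And>i. i \<in> I \<Longrightarrow> walsh_approximable (F i)) \<Longrightarrow> walsh_approximable (\<lambda>w. \<Sum>i\<in>I. F i w)"
  by (induction I rule: infinite_finite_induct)
     (auto intro: walsh_approximable_add walsh_approximable_const)

text \<open>Dynkin's argument: cylinders generate the sigma-algebra, are stable under intersection
  and have product indicators, while approximability passes to complements and countable disjoint
  unions.\<close>

lemma walsh_approximable_indicator:
  assumes "X \<in> sets cube"
  shows "walsh_approximable (indicator X)"
proof -
  let ?M = "\<lambda>_::nat. measure_pmf (bernoulli_pmf (1/2))"
  have sets: "sets cube = sigma_sets (\<Pi>\<^sub>E i\<in>UNIV. space (?M i)) (prod_algebra UNIV ?M)"
    unfolding cube_def by (rule sets_PiM)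
  have sp: "(\<Pi>\<^sub>E i\<in>(UNIV::nat set). space (?M i)) = (UNIV :: (nat \<Rightarrow> bool) set)" by (auto simp: PiE_def)
  from assms show ?thesis
    unfolding sets
  proof (induction rule: sigma_sets_induct_disjoint
      [OF Int_stable_prod_algebra prod_algebra_sets_into_space, consumes 1, case_names basic empty compl union])
    case (basic X)
    then obtain J E where X: "X = prod_emb UNIV ?M J (\<Pi>\<^sub>E j\<in>J. E j)" and J: "finite J"
      by (rule prod_algebraE) auto
    have ind: "indicator X w = (\<Prod>i\<in>J. indicator (E i) (w i) :: real)" for w
      using J unfolding X by (auto simp: prod_emb_def PiE_iff indicator_def space_PiM)
    obtain a where "\<And>w. (\<Prod>i\<in>J. indicator (E i) (w i) :: real) = walsh J a w"
      using prod_coordinates_eq_walsh[OF J, of "\<lambda>i. indicator (E i)"] by auto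
    then have "indicator X = walsh J a" using ind by auto
    then show ?case using walsh_approximable_walsh[OF J] by simp
  next
    case empty
    show ?case using walsh_approximable_const[of 0] by simp
  next
    case (compl X)
    have "indicator ((\<Pi>\<^sub>E i\<in>UNIV. space (?M i)) - X) = (\<lambda>w. 1 + - indicator X w :: real)"
      unfolding sp by (auto split: split_indicator)
    then show ?case
      using walsh_approximable_add[OF walsh_approximable_const walsh_approximable_uminus[OF compl.IH], of 1]
      by simp
  next
    case (union D)
    have D: "range D \<subseteq> sets cube" using union.hyps unfolding sets by auto
    then have U: "\<Union>(range D) \<in> sets cube" by auto
    show ?case
    proof (rule walsh_approximable_limit)
      show "bounded_measurable cube (indicator (\<Union>(range D)))"
        by (intro bm_intros U)
      fix e :: real assume e: "0 < e"
      \<comment> \<open>The squared L2 distance of nested indicators is the measure of the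
        difference, so continuity from below along these partial unions suffices.\<close>
      define B where "B n = (\<Union>i<n. D i)" for n
      have B: "B n \<in> sets cube" for n using D unfolding B_def by (intro sets.finite_UN) auto
      have BU: "(\<Union>n. B n) = \<Union>(range D)" by (auto simp: B_def)
      have "(\<lambda>n. measure cube (B n)) \<longlonglongrightarrow> measure cube (\<Union>n. B n)"
      proof (rule cube.finite_Lim_measure_incseq)
        show "incseq B" unfolding incseq_def B_def by (intro allI impI UN_mono) auto
      qed (use B in auto)
      then have "\<forall>\<^sub>F n in sequentially. measure cube (\<Union>(range D)) - e < measure cube (B n)"
        unfolding BU by (intro order_tendstoD(1)) (use e in auto)
      then obtain n where n: "measure cube (\<Union>(range D)) - e < measure cube (B n)"
        using eventually_happens'[OF sequentially_bot] by blast
      have ind: "indicator (B n) = (\<lambda>w. \<Sum>i<n. indicator (D i) w :: real)"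
        using union.hyps unfolding B_def
        by (intro ext indicator_UN_disjoint) (auto simp: disjoint_family_on_def)
      have "walsh_approximable (indicator (B n))"
        unfolding ind by (intro walsh_approximable_sum union.IH)
      moreover have "(\<integral>w. (indicator (\<Union>(range D)) w - indicator (B n) w)\<^sup>2 \<partial>cube) < e"
      proof -
        have sub: "B n \<subseteq> \<Union>(range D)" by (auto simp: B_def)
        then have "(indicator (\<Union>(range D)) w - indicator (B n) w)\<^sup>2 = (indicator (\<Union>(range D) - B n) w :: real)" for w
          by (auto split: split_indicator)
        then have "(\<integral>w. (indicator (\<Union>(range D)) w - indicator (B n) w)\<^sup>2 \<partial>cube)
            = measure cube (\<Union>(range D) - B n)"
          using U B by simp
        also have "\<dots> = measure cube (\<Union>(range D)) - measure cube (B n)"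
          using sub U B by (intro cube.finite_measure_Diff) auto
        finally show ?thesis using n by simp
      qed
      ultimately show "\<exists>G. walsh_approximable G \<and> (\<integral>w. (indicator (\<Union>(range D)) w - G w)\<^sup>2 \<partial>cube) < e"
        by blast
    qed
  qed
qed

lemma walsh_approximable_pm:
  assumes "boolean_function f"
  shows "walsh_approximable (\<lambda>w. pm (f w))"
proof -
  have [measurable]: "f \<in> measurable cube (count_space UNIV)"
    using assms by (simp add: boolean_function_def)
  define X where "X = {w \<in> space cube. f w}"
  have "X \<in> sets cube" unfolding X_def by measurable
  note X = walsh_approximable_indicator[OF this]
  have "(\<lambda>w. pm (f w)) = (\<lambda>w. indicator X w + indicator X w + - 1)"
    by (auto simp: X_def pm_def)
  then show ?thesis
    using walsh_approximable_add[OF walsh_approximable_add[OF X X] walsh_approximable_const[of "- 1"]] by simp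
qed

text \<open>For fixed \<open>A\<close> the Fourier coefficients minimise the L2 distance, so they
  may replace those of any approximating polynomial.\<close>

lemma fourier_approximation:
  assumes "walsh_approximable F" "0 < e"
  shows "\<exists>A. finite A \<and> (\<integral>w. (F w - walsh A (fourier F) w)\<^sup>2 \<partial>cube) < e"
proof -
  obtain A a where A: "finite A" "(\<integral>w. (F w - walsh A a w)\<^sup>2 \<partial>cube) < e"
    using assms unfolding walsh_approximable_def by meson
  have F: "bounded_measurable cube F" using assms by (simp add: walsh_approximable_def)
  have "(\<integral>w. (F w - walsh A (fourier F) w)\<^sup>2 \<partial>cube) \<le> (\<integral>w. (F w - walsh A a w)\<^sup>2 \<partial>cube)"
    unfolding integral_diff_walsh_squared[OF F A(1)] by (simp add: sum_nonneg)
  then show ?thesis using A by force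
qed

section \<open>Noise\<close>

lemma pmf_noise:
  assumes "0 \<le> \<epsilon>" "\<epsilon> \<le> 1"
  shows "pmf (noise_pmf \<epsilon>) (x, y) = (\<epsilon> / 2 + (if x = y then 1 - \<epsilon> else 0)) / 2"
  using assms by (cases x; cases y) (simp_all add: noise_pmf_def pmf_bind field_simps)

lemma map_fst_noise_pmf: "map_pmf fst (noise_pmf \<epsilon>) = bernoulli_pmf (1/2)"
  by (simp add: noise_pmf_def map_bind_pmf bind_return_pmf')

lemma map_snd_noise_pmf:
  assumes "0 \<le> \<epsilon>" "\<epsilon> \<le> 1"
  shows "map_pmf snd (noise_pmf \<epsilon>) = bernoulli_pmf (1/2)"
proof (rule pmf_eqI)
  fix b
  show "pmf (map_pmf snd (noise_pmf \<epsilon>)) b = pmf (bernoulli_pmf (1/2)) b"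
    using assms by (cases b) (simp_all add: noise_pmf_def map_bind_pmf pmf_bind field_simps)
qed

lemma integral_noise_pmf:
  fixes g :: "bool \<times> bool \<Rightarrow> real"
  assumes "0 \<le> \<epsilon>" "\<epsilon> \<le> 1"
  shows "(\<integral>z. g z \<partial>measure_pmf (noise_pmf \<epsilon>)) = (g (True, True) + g (False, False)) * (1 - \<epsilon> / 2) / 2
     + (g (True, False) + g (False, True)) * (\<epsilon> / 2) / 2"
proof -
  have "(\<integral>z. g z \<partial>measure_pmf (noise_pmf \<epsilon>)) = (\<Sum>z\<in>UNIV. pmf (noise_pmf \<epsilon>) z * g z)"
    by (subst integral_measure_pmf[where A = UNIV]) auto
  also have "(UNIV :: (bool \<times> bool) set) = {(True, True), (False, False), (True, False), (False, True)}"
    by auto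
  finally show ?thesis by (simp add: pmf_noise[OF assms] field_simps)
qed

interpretation noise_cube: prob_space "noise_cube \<epsilon>" for \<epsilon>
  unfolding noise_cube_def by (intro prob_space_PiM measure_pmf.prob_space_axioms)

lemmas noise_integrable = bounded_measurable_integrable[OF noise_cube.finite_measure_axioms]
lemmas noise_Cauchy_Schwarz = Cauchy_Schwarz_integral[OF noise_cube.finite_measure_axioms]

lemma measurable_noise_coordinate [measurable]:
  "(\<lambda>z. z i) \<in> measurable (noise_cube \<epsilon>) (count_space UNIV)"
proof -
  have "(\<lambda>z. z i) \<in> measurable (noise_cube \<epsilon>) (measure_pmf (noise_pmf \<epsilon>))"
    unfolding noise_cube_def by (rule measurable_component_singleton) simp
  then show ?thesis by simp
qed

lemma measurable_noise_marginal: "(\<lambda>z. p \<circ> z) \<in> measurable (noise_cube \<epsilon>) cube"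
proof (subst cube_def, rule measurable_PiM_single')
  show "(\<lambda>z. (p \<circ> z) i) \<in> measurable (noise_cube \<epsilon>) (measure_pmf (bernoulli_pmf (1/2)))" for i
    using measurable_compose[OF measurable_noise_coordinate, of p "count_space UNIV" i \<epsilon>] by simp
qed auto

lemma distr_noise_marginal:
  assumes "map_pmf p (noise_pmf \<epsilon>) = bernoulli_pmf (1/2)"
  shows "distr (noise_cube \<epsilon>) cube (\<lambda>z. p \<circ> z) = cube"
proof -
  have "distr (measure_pmf (noise_pmf \<epsilon>)) (measure_pmf (bernoulli_pmf (1/2))) p
      = measure_pmf (map_pmf p (noise_pmf \<epsilon>))"
    by (subst map_pmf_rep_eq) (auto intro!: distr_cong)
  also have "\<dots> = measure_pmf (bernoulli_pmf (1/2))" by (simp add: assms)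
  finally show ?thesis
    unfolding cube_def noise_cube_def comp_def
    by (intro distr_PiM_UNIV_pointwise measure_pmf.prob_space_axioms) auto
qed

lemma integral_noise_marginal:
  fixes F :: "(nat \<Rightarrow> bool) \<Rightarrow> real"
  assumes "map_pmf p (noise_pmf \<epsilon>) = bernoulli_pmf (1/2)" "F \<in> borel_measurable cube"
  shows "(\<integral>z. F (p \<circ> z) \<partial>noise_cube \<epsilon>) = (\<integral>w. F w \<partial>cube)"
  using integral_distr[OF measurable_noise_marginal assms(2), of \<epsilon> p]
  by (simp add: distr_noise_marginal[OF assms(1)])

text \<open>The integrand depends only on the coordinates in \<open>J\<close>, so the integral
  descends to a finite product measure, where the factors separate.\<close>

lemma integral_noise_prod:
  fixes \<phi> :: "nat \<Rightarrow> bool \<times> bool \<Rightarrow> real"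
  assumes J: "finite J"
  shows "(\<integral>z. (\<Prod>i\<in>J. \<phi> i (z i)) \<partial>noise_cube \<epsilon>) = (\<Prod>i\<in>J. \<integral>x. \<phi> i x \<partial>measure_pmf (noise_pmf \<epsilon>))"
proof -
  let ?M = "\<lambda>_::nat. measure_pmf (noise_pmf \<epsilon>)"
  interpret product_prob_space ?M UNIV
    by (simp add: product_prob_space_def product_prob_space_axioms_def
        product_sigma_finite_def prob_space_imp_sigma_finite measure_pmf.prob_space_axioms)
  have [measurable]: "(\<lambda>x. \<Prod>i\<in>J. \<phi> i (x i)) \<in> borel_measurable (PiM J ?M)"
    by (intro borel_measurable_prod measurable_compose[OF measurable_component_singleton]) auto
  have "(\<integral>z. (\<Prod>i\<in>J. \<phi> i (z i)) \<partial>noise_cube \<epsilon>) = (\<integral>z. (\<Prod>i\<in>J. \<phi> i (restrict z J i)) \<partial>PiM UNIV ?M)"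
    by (simp add: noise_cube_def)
  also have "\<dots> = (\<integral>x. (\<Prod>i\<in>J. \<phi> i (x i)) \<partial>distr (PiM UNIV ?M) (PiM J ?M) (\<lambda>z. restrict z J))"
    by (subst integral_distr) (auto intro: measurable_restrict_subset)
  also have "\<dots> = (\<integral>x. (\<Prod>i\<in>J. \<phi> i (x i)) \<partial>PiM J ?M)"
    using J by (subst distr_PiM_restrict_finite) auto
  also have "\<dots> = (\<Prod>i\<in>J. \<integral>x. \<phi> i x \<partial>measure_pmf (noise_pmf \<epsilon>))"
    using J by (intro product_integral_prod) (auto intro: integrable_measure_pmf_finite)
  finally show ?thesis .
qed

text \<open>By independence the integral is a product over coordinates: one lying in both sets
  contributes \<open>1 - \<epsilon>\<close>, one lying in a single set contributes the mean 0 of a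
  fair sign.\<close>

lemma noise_chi_correlation:
  assumes \<epsilon>: "0 \<le> \<epsilon>" "\<epsilon> \<le> 1" and fin: "finite S" "finite T"
  shows "(\<integral>z. chi S (fst \<circ> z) * chi T (snd \<circ> z) \<partial>noise_cube \<epsilon>) = (if S = T then (1 - \<epsilon>) ^ card S else 0)"
proof -
  define \<phi> where "\<phi> i x = (if i \<in> S then pm (fst x) else 1) * (if i \<in> T then pm (snd x) else 1)" for i x
  have "chi S (fst \<circ> z) * chi T (snd \<circ> z) = (\<Prod>i\<in>S \<union> T. \<phi> i (z i))" for z
  proof -
    have "chi S (fst \<circ> z) = (\<Prod>i\<in>S \<union> T. if i \<in> S then pm (fst (z i)) else 1)"
      unfolding chi_def using fin by (intro prod.mono_neutral_cong_left) auto
    moreover have "chi T (snd \<circ> z) = (\<Prod>i\<in>S \<union> T. if i \<in> T then pm (snd (z i)) else 1)"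
      unfolding chi_def using fin by (intro prod.mono_neutral_cong_left) auto
    ultimately show ?thesis by (simp add: \<phi>_def prod.distrib)
  qed
  then have "(\<integral>z. chi S (fst \<circ> z) * chi T (snd \<circ> z) \<partial>noise_cube \<epsilon>)
      = (\<Prod>i\<in>S \<union> T. \<integral>x. \<phi> i x \<partial>measure_pmf (noise_pmf \<epsilon>))"
    using fin by (simp add: integral_noise_prod)
  also have "\<dots> = (\<Prod>i\<in>S \<union> T. if i \<in> S \<inter> T then 1 - \<epsilon> else 0)"
    by (intro prod.cong refl) (auto simp: integral_noise_pmf[OF \<epsilon>] \<phi>_def pm_def field_simps)
  also have "\<dots> = (if S = T then (1 - \<epsilon>) ^ card S else 0)"
    using fin by (auto intro!: prod_zero)
  finally show ?thesis .
qed

lemma noise_walsh_correlation: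
  assumes \<epsilon>: "0 \<le> \<epsilon>" "\<epsilon> \<le> 1" and A: "finite A"
  shows "(\<integral>z. walsh A a (fst \<circ> z) * walsh A a (snd \<circ> z) \<partial>noise_cube \<epsilon>)
     = (\<Sum>S\<in>Pow A. (1 - \<epsilon>) ^ card S * (a S)\<^sup>2)"
proof -
  have bm: "bounded_measurable (noise_cube \<epsilon>) (\<lambda>z. chi S (p \<circ> z))" for S p
    by (rule bounded_measurable_compose[OF bounded_measurable_chi measurable_noise_marginal])
  have int: "integrable (noise_cube \<epsilon>) (\<lambda>z. chi S (fst \<circ> z) * chi T (snd \<circ> z))" for S T
    by (intro noise_integrable bounded_measurable_mult bm)
  have "(\<integral>z. walsh A a (fst \<circ> z) * walsh A a (snd \<circ> z) \<partial>noise_cube \<epsilon>)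
      = (\<integral>z. (\<Sum>S\<in>Pow A. \<Sum>T\<in>Pow A. a S * a T * (chi S (fst \<circ> z) * chi T (snd \<circ> z))) \<partial>noise_cube \<epsilon>)"
    by (simp add: walsh_def sum_product mult_ac)
  also have "\<dots> = (\<Sum>S\<in>Pow A. \<Sum>T\<in>Pow A. a S * a T * (\<integral>z. chi S (fst \<circ> z) * chi T (snd \<circ> z) \<partial>noise_cube \<epsilon>))"
    using int by simp
  also have "\<dots> = (\<Sum>S\<in>Pow A. \<Sum>T\<in>Pow A. if S = T then (1 - \<epsilon>) ^ card S * (a S)\<^sup>2 else 0)"
  proof (intro sum.cong refl)
    fix S T assume "S \<in> Pow A" "T \<in> Pow A"
    then have "finite S" "finite T" using A finite_subset by auto
    then show "a S * a T * (\<integral>z. chi S (fst \<circ> z) * chi T (snd \<circ> z) \<partial>noise_cube \<epsilon>)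
        = (if S = T then (1 - \<epsilon>) ^ card S * (a S)\<^sup>2 else 0)"
      by (simp add: noise_chi_correlation[OF \<epsilon>] power2_eq_square)
  qed
  also have "\<dots> = (\<Sum>S\<in>Pow A. (1 - \<epsilon>) ^ card S * (a S)\<^sup>2)"
    using A by simp
  finally show ?thesis .
qed

text \<open>Both marginals of the noise measure are uniform, so Cauchy-Schwarz on
  \<open>noise_cube\<close> turns into norms on \<open>cube\<close>: the noise form is continuous in
  L2.\<close>

lemma noise_form_bound:
  assumes \<epsilon>: "0 \<le> \<epsilon>" "\<epsilon> \<le> 1" and U: "bounded_measurable cube U" and V: "bounded_measurable cube V"
  shows "\<bar>\<integral>z. U (fst \<circ> z) * V (snd \<circ> z) \<partial>noise_cube \<epsilon>\<bar>
     \<le> sqrt (\<integral>w. (U w)\<^sup>2 \<partial>cube) * sqrt (\<integral>w. (V w)\<^sup>2 \<partial>cube)"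
proof -
  have "(\<integral>z. U (fst \<circ> z) * V (snd \<circ> z) \<partial>noise_cube \<epsilon>)\<^sup>2
      \<le> (\<integral>z. (U (fst \<circ> z))\<^sup>2 \<partial>noise_cube \<epsilon>) * (\<integral>z. (V (snd \<circ> z))\<^sup>2 \<partial>noise_cube \<epsilon>)"
    using U V by (intro noise_Cauchy_Schwarz bounded_measurable_compose[OF _ measurable_noise_marginal])
  also have "(\<integral>z. (U (fst \<circ> z))\<^sup>2 \<partial>noise_cube \<epsilon>) = (\<integral>w. (U w)\<^sup>2 \<partial>cube)"
    by (rule integral_noise_marginal[OF map_fst_noise_pmf])
       (intro bounded_measurableD bm_intros U)
  also have "(\<integral>z. (V (snd \<circ> z))\<^sup>2 \<partial>noise_cube \<epsilon>) = (\<integral>w. (V w)\<^sup>2 \<partial>cube)"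
    by (rule integral_noise_marginal[OF map_snd_noise_pmf[OF \<epsilon>]])
       (intro bounded_measurableD bm_intros V)
  finally show ?thesis
    by (simp only: comp_def real_sqrt_mult[symmetric] real_sqrt_abs[symmetric] real_sqrt_le_iff)
qed

text \<open>A finite \<open>A\<close> depending on \<open>f\<close> and \<open>\<delta>\<close>
  stands in for the full spectral expansion, which avoids infinite sums over sets.\<close>

lemma noise_correlation_approx:
  assumes f: "boolean_function f" and \<epsilon>: "0 \<le> \<epsilon>" "\<epsilon> \<le> 1" and \<delta>: "0 < \<delta>"
  shows "\<exists>A. finite A \<and> \<bar>(\<integral>z. pm (f (fst \<circ> z)) * pm (f (snd \<circ> z)) \<partial>noise_cube \<epsilon>)
     - (\<Sum>S\<in>Pow A. (1 - \<epsilon>) ^ card S * (fourier (\<lambda>w. pm (f w)) S)\<^sup>2)\<bar> \<le> \<delta>"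
proof -
  define F where "F = (\<lambda>w. pm (f w))"
  have F: "walsh_approximable F" "bounded_measurable cube F"
    using walsh_approximable_pm[OF f] by (auto simp: F_def walsh_approximable_def)
  have F1: "(\<integral>w. (F w)\<^sup>2 \<partial>cube) = 1"
    using cube.prob_space by (simp add: F_def power2_eq_square)
  obtain A where A: "finite A" "(\<integral>w. (F w - walsh A (fourier F) w)\<^sup>2 \<partial>cube) < (\<delta> / 2)\<^sup>2"
    using fourier_approximation[OF F(1), of "(\<delta> / 2)\<^sup>2"] \<delta> by auto
  define P where "P = walsh A (fourier F)"
  define U where "U w = F w - P w" for w
  have P: "bounded_measurable cube P" unfolding P_def by (intro bm_intros)
  have U: "bounded_measurable cube U" unfolding U_def by (intro bm_intros F P)
  have U2: "sqrt (\<integral>w. (U w)\<^sup>2 \<partial>cube) \<le> \<delta> / 2"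
    using A(2) \<delta> by (intro real_le_lsqrt) (auto simp: U_def P_def)
  have P2: "sqrt (\<integral>w. (P w)\<^sup>2 \<partial>cube) \<le> 1"
    using bessel[OF F(2) A(1)] by (simp add: P_def walsh_parseval[OF A(1)] F1)
  let ?N = "\<lambda>X Y. \<integral>z. X (fst \<circ> z) * Y (snd \<circ> z) \<partial>noise_cube \<epsilon>"
  have int: "integrable (noise_cube \<epsilon>) (\<lambda>z. X (fst \<circ> z) * Y (snd \<circ> z))"
    if "bounded_measurable cube X" "bounded_measurable cube Y" for X Y
    using that by (intro noise_integrable bounded_measurable_mult
        bounded_measurable_compose[OF _ measurable_noise_marginal])
  \<comment> \<open>Bilinearity, exchanging one argument at a time: \<open>F\<close> and
    \<open>P\<close> have norm at most 1, so each exchange costs at most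
    \<open>\<delta> / 2\<close>.\<close>
  have "?N F F - ?N P P = ?N U F + ?N P U"
  proof -
    have "?N U F = ?N F F - ?N P F" "?N P U = ?N P F - ?N P P"
      using F P by (simp_all add: U_def left_diff_distrib right_diff_distrib int)
    then show ?thesis by simp
  qed
  also have "\<bar>\<dots>\<bar> \<le> \<bar>?N U F\<bar> + \<bar>?N P U\<bar>" by (rule abs_triangle_ineq)
  also have "\<dots> \<le> \<delta> / 2 + \<delta> / 2"
  proof (intro add_mono)
    have "\<bar>?N U F\<bar> \<le> sqrt (\<integral>w. (U w)\<^sup>2 \<partial>cube) * sqrt (\<integral>w. (F w)\<^sup>2 \<partial>cube)"
      by (intro noise_form_bound \<epsilon> U F)
    then show "\<bar>?N U F\<bar> \<le> \<delta> / 2" using U2 by (simp add: F1)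
    have "\<bar>?N P U\<bar> \<le> sqrt (\<integral>w. (P w)\<^sup>2 \<partial>cube) * sqrt (\<integral>w. (U w)\<^sup>2 \<partial>cube)"
      by (intro noise_form_bound \<epsilon> U P)
    also have "\<dots> \<le> 1 * (\<delta> / 2)"
      using U2 P2 by (intro mult_mono) auto
    finally show "\<bar>?N P U\<bar> \<le> \<delta> / 2" by simp
  qed
  finally have "\<bar>?N F F - ?N P P\<bar> \<le> \<delta>" by simp
  moreover have "?N P P = (\<Sum>S\<in>Pow A. (1 - \<epsilon>) ^ card S * (fourier F S)\<^sup>2)"
    unfolding P_def by (rule noise_walsh_correlation[OF \<epsilon> A(1)])
  ultimately show ?thesis using A(1) by (auto simp: F_def)
qed

text \<open>Sets with more than \<open>m\<close> elements are damped by at least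
  \<open>\<rho> ^ m\<close> and have total weight at most 1; the levels 1 to \<open>m\<close> are
  counted without damping, with \<open>d\<close> standing for size \<open>Suc d\<close>.\<close>

lemma damped_spectrum_le:
  fixes c :: "nat set \<Rightarrow> real"
  assumes \<rho>: "0 \<le> \<rho>" "\<rho> \<le> 1" and A: "finite A" and c: "\<And>S. 0 \<le> c S" and total: "(\<Sum>S\<in>Pow A. c S) \<le> 1"
  shows "(\<Sum>S\<in>Pow A - {{}}. \<rho> ^ card S * c S) \<le> \<rho> ^ m + (\<Sum>d<m. \<Sum>S | S \<subseteq> A \<and> card S = Suc d. c S)"
proof -
  have "(\<Sum>S\<in>Pow A - {{}}. \<rho> ^ card S * c S)
      \<le> (\<Sum>S\<in>Pow A - {{}}. \<rho> ^ m * c S + (\<Sum>d<m. if card S = Suc d then c S else 0))"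
  proof (rule sum_mono)
    fix S assume S: "S \<in> Pow A - {{}}"
    then have "card S \<noteq> 0" using finite_subset[OF _ A, of S] by auto
    then obtain k where k: "card S = Suc k" by (cases "card S") auto
    show "\<rho> ^ card S * c S \<le> \<rho> ^ m * c S + (\<Sum>d<m. if card S = Suc d then c S else 0)"
    proof (cases "k < m")
      case True
      then have "(\<Sum>d<m. if card S = Suc d then c S else 0) = c S" by (simp add: k)
      moreover have "\<rho> ^ card S * c S \<le> 1 * c S"
        using \<rho> c by (intro mult_right_mono power_le_one) auto
      moreover have "0 \<le> \<rho> ^ m * c S" using \<rho> c by simp
      ultimately show ?thesis by linarith
    next
      case False
      then have "\<rho> ^ card S \<le> \<rho> ^ m" using \<rho> k by (intro power_decreasing) auto
      then have "\<rho> ^ card S * c S \<le> \<rho> ^ m * c S" using c by (intro mult_right_mono) auto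
      moreover have "0 \<le> (\<Sum>d<m. if card S = Suc d then c S else 0)" using c by (intro sum_nonneg) auto
      ultimately show ?thesis by linarith
    qed
  qed
  also have "\<dots> \<le> (\<Sum>S\<in>Pow A. \<rho> ^ m * c S + (\<Sum>d<m. if card S = Suc d then c S else 0))"
    using A \<rho> c by (intro sum_mono2) (auto intro!: add_nonneg_nonneg sum_nonneg)
  also have "\<dots> = \<rho> ^ m * (\<Sum>S\<in>Pow A. c S) + (\<Sum>S\<in>Pow A. \<Sum>d<m. if card S = Suc d then c S else 0)"
    by (simp add: sum.distrib sum_distrib_left)
  also have "(\<Sum>S\<in>Pow A. \<Sum>d<m. if card S = Suc d then c S else 0)
      = (\<Sum>d<m. \<Sum>S\<in>Pow A. if card S = Suc d then c S else 0)"
    by (rule sum.swap)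
  also have "\<dots> = (\<Sum>d<m. \<Sum>S\<in>{S \<in> Pow A. card S = Suc d}. c S)"
    using A by (intro sum.cong refl sum.inter_filter[symmetric]) simp
  also have "\<rho> ^ m * (\<Sum>S\<in>Pow A. c S) \<le> \<rho> ^ m * 1"
    using \<rho> total by (intro mult_left_mono) auto
  finally show ?thesis by (simp add: Pow_def)
qed

text \<open>The empty set contributes the squared mean, and the other spectral terms are
  nonnegative, which settles the absolute value. Since \<open>A\<close> is absent from the bound,
  the approximation error \<open>\<delta>\<close> can tend to 0.\<close>

lemma noise_covariance_le:
  assumes f: "boolean_function f" and h: "H f \<le> ennreal h" "0 < h" and \<epsilon>: "0 \<le> \<epsilon>" "\<epsilon> \<le> 1"
  shows "\<bar>(\<integral>z. pm (f (fst \<circ> z)) * pm (f (snd \<circ> z)) \<partial>noise_cube \<epsilon>) - (\<integral>w. pm (f w) \<partial>cube)\<^sup>2\<bar>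
     \<le> (1 - \<epsilon>) ^ m + (\<Sum>d<m. 2 ^ Suc d * (1 + 3 ^ d)\<^sup>2) * sqrt h"
proof (rule field_le_epsilon)
  fix \<delta> :: real assume "0 < \<delta>"
  define F where "F = (\<lambda>w. pm (f w))"
  let ?c = "\<lambda>S. (fourier F S)\<^sup>2"
  obtain A where A: "finite A" and approx: "\<bar>(\<integral>z. pm (f (fst \<circ> z)) * pm (f (snd \<circ> z)) \<partial>noise_cube \<epsilon>)
     - (\<Sum>S\<in>Pow A. (1 - \<epsilon>) ^ card S * ?c S)\<bar> \<le> \<delta>"
    using noise_correlation_approx[OF f \<epsilon> \<open>0 < \<delta>\<close>] unfolding F_def by auto
  have F: "bounded_measurable cube F"
    unfolding F_def using f by (intro bm_intros) (simp add: boolean_function_def)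
  have total: "(\<Sum>S\<in>Pow A. ?c S) \<le> 1"
    using bessel[OF F A] cube.prob_space by (simp add: F_def power2_eq_square)
  have "(\<Sum>S\<in>Pow A. (1 - \<epsilon>) ^ card S * ?c S)
      = (\<integral>w. pm (f w) \<partial>cube)\<^sup>2 + (\<Sum>S\<in>Pow A - {{}}. (1 - \<epsilon>) ^ card S * ?c S)"
    using A by (subst sum.remove[of _ "{}"]) (auto simp: fourier_def F_def)
  moreover have "0 \<le> (\<Sum>S\<in>Pow A - {{}}. (1 - \<epsilon>) ^ card S * ?c S)"
    using \<epsilon> by (intro sum_nonneg) auto
  moreover have "(\<Sum>S\<in>Pow A - {{}}. (1 - \<epsilon>) ^ card S * ?c S)
      \<le> (1 - \<epsilon>) ^ m + (\<Sum>d<m. \<Sum>S | S \<subseteq> A \<and> card S = Suc d. ?c S)"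
    using \<epsilon> A total by (intro damped_spectrum_le) auto
  moreover have "(\<Sum>d<m. \<Sum>S | S \<subseteq> A \<and> card S = Suc d. ?c S)
      \<le> (\<Sum>d<m. 2 ^ Suc d * ((1 + 3 ^ d)\<^sup>2 * sqrt h))"
    unfolding F_def by (intro sum_mono level_weight_le f h A)
  moreover have "\<dots> = (\<Sum>d<m. 2 ^ Suc d * (1 + 3 ^ d)\<^sup>2) * sqrt h"
    by (simp add: sum_distrib_right mult.assoc)
  ultimately show "\<bar>(\<integral>z. pm (f (fst \<circ> z)) * pm (f (snd \<circ> z)) \<partial>noise_cube \<epsilon>) - (\<integral>w. pm (f w) \<partial>cube)\<^sup>2\<bar>
     \<le> (1 - \<epsilon>) ^ m + (\<Sum>d<m. 2 ^ Suc d * (1 + 3 ^ d)\<^sup>2) * sqrt h + \<delta>"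
    using approx by linarith
qed

theorem mainTheorem15:
  fixes f :: "nat \<Rightarrow> (nat \<Rightarrow> bool) \<Rightarrow> bool"
  assumes bool: "\<And>n. boolean_function (f n)"
    and know: "\<And>n. \<exists>p > 1/2. knowable p (f n)"
    and H0: "(\<lambda>n. H (f n)) \<longlonglongrightarrow> 0"
  shows "noise_sensitive f"
  unfolding noise_sensitive_def
proof (intro allI impI, elim conjE)
  fix \<epsilon> :: real assume \<epsilon>: "0 < \<epsilon>" "\<epsilon> \<le> 1"
  show "(\<lambda>n. (\<integral>z. pm (f n (fst \<circ> z)) * pm (f n (snd \<circ> z)) \<partial>noise_cube \<epsilon>)
      - (\<integral>w. pm (f n w) \<partial>cube)\<^sup>2) \<longlonglongrightarrow> 0"
  proof (rule tendstoI)
    fix \<eta> :: real assume \<eta>: "0 < \<eta>"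
    \<comment> \<open>The order matters: \<open>K\<close> depends on \<open>m\<close>, so the
      threshold for \<open>H\<close> is chosen only after \<open>m\<close> is fixed.\<close>
    obtain m where m: "(1 - \<epsilon>) ^ m < \<eta> / 2"
      using real_arch_pow_inv[of "\<eta> / 2" "1 - \<epsilon>"] \<eta> \<epsilon> by auto
    define K where "K = (\<Sum>d<m. 2 ^ Suc d * (1 + 3 ^ d)\<^sup>2 :: real)"
    have K: "0 \<le> K" unfolding K_def by (intro sum_nonneg) auto
    \<comment> \<open>Using \<open>K + 1\<close> keeps the denominator positive even for
      \<open>K = 0\<close> and makes \<open>K * r < \<eta> / 2\<close> strict.\<close>
    define r where "r = \<eta> / (2 * (K + 1))"
    have r: "0 < r" "K * r < \<eta> / 2"
      using K \<eta> by (auto simp: r_def field_simps)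
    have "\<forall>\<^sub>F n in sequentially. H (f n) < ennreal (r\<^sup>2)"
      using r by (intro order_tendstoD(2)[OF H0]) auto
    then show "\<forall>\<^sub>F n in sequentially. dist ((\<integral>z. pm (f n (fst \<circ> z)) * pm (f n (snd \<circ> z)) \<partial>noise_cube \<epsilon>)
      - (\<integral>w. pm (f n w) \<partial>cube)\<^sup>2) 0 < \<eta>"
    proof eventually_elim
      case (elim n)
      have "\<bar>(\<integral>z. pm (f n (fst \<circ> z)) * pm (f n (snd \<circ> z)) \<partial>noise_cube \<epsilon>) - (\<integral>w. pm (f n w) \<partial>cube)\<^sup>2\<bar>
          \<le> (1 - \<epsilon>) ^ m + K * sqrt (r\<^sup>2)"
        unfolding K_def using elim r \<epsilon> by (intro noise_covariance_le bool) auto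
      then show ?case using m r by (simp add: dist_real_def)
    qed
  qed
qed

end
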